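(* Let $\Phi$ be a consistent set of formulas with $\|\Phi\|^{\mathbf{B}}_{\mathbf{T}^{\Phi},e^{\Phi}}=1$. Then the term structure $\langle\mathbf{B},\mathbf{T}^{\Phi}\rangle$ associated to $\Phi$ is a free structure in the class of the reduced models of $\Phi$, i.e., for every reduced structure $\langle\mathbf{A},\mathbf{M}\rangle$ and every $\mathbf{M}$-evaluation $v$ such that $\|\Phi\|^{\mathbf{A}}_{\mathbf{M},v}=1$, there is a unique homomorphism $\langle f,g\rangle$ from $\langle\mathbf{B},\mathbf{T}^{\Phi}\rangle$ to $\langle\mathbf{A},\mathbf{M}\rangle$ such that $g(\overline{x})=v(x)$ for every variable $x\in Var$.
   Context: **Logic.** MTL is the monoidal t-norm based logic, with algebraic semantics given by MTL-algebras, i.e. bounded integral commutative residuated lattices $(A,\sqcap,\sqcup,*,\Rightarrow,0,1)$ satisfying $(x\Rightarrow y)\sqcup(y\Rightarrow x)=1$; the connectives $\wedge,\vee,\&,\rightarrow,\overline 0,\overline 1$ are interpreted by $\sqcap,\sqcup,*,\Rightarrow,0,1$. $L$ is a fixed core fuzzy logic (an expansion of MTL with the congruence property for $\leftrightarrow$ and the local deduction theorem: $T,\varphi\vdash\psi$ iff $T\vdash\varphi^n\rightarrow\psi$ for some $n$) whose propositional language contains only the truth-constants $\overline 1$ and $\overline 0$. $L$-algebras are the corresponding algebras (MTL-algebras, with extra operations for extra connectives, validating $L$). A predicate language consists of a nonempty set of predicate symbols, a set of function symbols, and arities (0-ary function symbols are individual constants). Terms and formulas are as in classical predicate logic; $Var$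 is the set of object variables. The predicate logic $L\forall^m$ has as axioms the first-order instances of the axioms of $L$ and ($\forall1$) $(\forall x)\varphi(x)\rightarrow\varphi(t)$, ($\exists1$) $\varphi(t)\rightarrow(\exists x)\varphi(x)$ ($t$ substitutable for $x$ in $\varphi$), ($\forall2$) $(\forall x)(\xi\rightarrow\varphi)\rightarrow(\xi\rightarrow(\forall x)\varphi)$, ($\exists2$) $(\forall x)(\varphi\rightarrow\xi)\rightarrow((\exists x)\varphi\rightarrow\xi)$ ($x$ not free in $\xi$); its rules are those of $L$ and generalization (from $\varphi$ infer $(\forall x)\varphi$). Proof and provability are defined analogously to the classical notions; $\Phi\vdash\varphi$ denotes provability in $L\forall^m$ from $\Phi$. $\Phi$ is consistent if $\Phi\not\vdash\overline 0$. **Similarity.** The language has a binary predicate symbol $\approx$ interpreted as a similarity, and the axiomatization of $L\forall^m$ contains the axioms: $(\forall x)\,x\approx x$; $(\forall x)(\forall y)(x\approx y\rightarrow y\approx x)$; $(\forall x)(\forall y)(\forall z)(x\approx y\,\&\,y\approx z\rightarrow x\approx z)$; for each $n$-ary function symbol $F$, the universal closure of $x_1\approx y_1\&\cdots\&x_n\approx y_n\rightarrow F(x_1,\dots,x_n)\approx F(y_1,\dots,y_n)$; for each $n$-ary predicate symbol $P$, the universal closure of $x_1\approx y_1\&\cdots\&x_n\approx y_n\rightarrow(P(x_1,\dots,x_n)\leftrightarrow P(y_1,\dots,y_n))$. **Semantics.** For an $L$-algebra $\mathbf A$, an $\mathbf A$-structure $\mathbf M$ has a nonempty domain $M$, a function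 $P_{\mathbf M}:M^n\to\mathbf A$ for each $n$-ary predicate symbol $P$ (an element of $\mathbf{A}$ if $n=0$), and a function $F_{\mathbf M}:M^n\to M$ for each $n$-ary function symbol $F$ (an element of $M$ if $n=0$). An $\mathbf M$-evaluation is a map $v:Var\to M$. Values $\|t\|^{\mathbf A}_{\mathbf M,v}\in M$ of terms and truth values $\|\varphi\|^{\mathbf A}_{\mathbf M,v}\in\mathbf A$ of formulas are defined recursively as usual, connectives being interpreted by the operations of $\mathbf A$, $\forall$ by infimum and $\exists$ by supremum over $M$ (undefined if these do not exist). $\mathbf M$ is safe if $\|\varphi\|^{\mathbf A}_{\mathbf M,v}$ is defined for all $\varphi$ and $v$. A structure $\langle\mathbf A,\mathbf M\rangle$ is an $L$-algebra $\mathbf{A}$ with a safe $\mathbf A$-structure $\mathbf{M}$ (interpreting $\approx$ as a similarity, i.e. the axioms for $\approx$ above have value $1$). $\|\Phi\|^{\mathbf A}_{\mathbf M,v}=1$ means $\|\varphi\|^{\mathbf A}_{\mathbf M,v}=1$ for all $\varphi\in\Phi$. A structure is reduced if its Leibniz congruence is the identity; equivalently, it has the equality property: for all $d,e\in M$, $\approx_{\mathbf M}(d,e)=1$ iff $d=e$. **Homomorphisms.** A homomorphism from $\langle\mathbf A,\mathbf M\rangle$ to $\langle\mathbf C,\mathbf N\rangle$ is a pair $\langle f,g\rangle$ with $f:\mathbf A\to\mathbf C$ a homomorphism of $L$-algebras and $g:M\to N$ such that $g(F_{\mathbf M}(d_1,\dots,d_n))=F_{\mathbf N}(g(d_1),\dots,g(d_n))$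 for every function symbol $F$, and $P_{\mathbf M}(d_1,\dots,d_n)=1$ implies $P_{\mathbf N}(g(d_1),\dots,g(d_n))=1$ for every predicate symbol $P$ (all $d_i\in M$). **Term structure.** For a set of formulas $\Phi$ and terms $t_1,t_2$, put $t_1\sim t_2$ iff $\Phi\vdash t_1\approx t_2$; this is an equivalence relation, and $\overline t$ is the class of $t$. For consistent $\Phi$, the term structure $\langle\mathbf B,\mathbf T^\Phi\rangle$ associated to $\Phi$ has $\mathbf B$ the two-valued Boolean algebra, domain $T^\Phi$ the set of all $\sim$-classes of terms, $F_{\mathbf T^\Phi}(\overline t_1,\dots,\overline t_n)=\overline{F(t_1,\dots,t_n)}$, and $P_{\mathbf T^\Phi}(\overline t_1,\dots,\overline t_n)=1$ if $\Phi\vdash P(t_1,\dots,t_n)$ and $0$ otherwise (this is well defined). The canonical evaluation $e^\Phi$ is $e^\Phi(x)=\overline x$ for every $x\in Var$.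
   Formalization: Generalization over x requires x not free in the hypotheses used (else Φ={P(x)} proves P(y) and the claim fails); "only the truth-constants" is read as: every variable-free formula of L is equivalent to 0 or 1, as needed for B to be a well-defined L-algebra mapping into all others. *)

theory Defs
  imports Main "HOL-Library.FuncSet"
begin

section \<open>Propositional logics expanding MTL\<close>

datatype 'c pform =
    PVar nat | PBot | PTop
  | PAnd "'c pform" "'c pform"
  | POr "'c pform" "'c pform"
  | PFus "'c pform" "'c pform"
  | PImp "'c pform" "'c pform"
  | PConn 'c "'c pform list"

definition PIff :: "'c pform \<Rightarrow> 'c pform \<Rightarrow> 'c pform" where
  "PIff \<phi> \<psi> = PFus (PImp \<phi> \<psi>) (PImp \<psi> \<phi>)"

fun ppow :: "'c pform \<Rightarrow> nat \<Rightarrow> 'c pform" where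
  "ppow \<phi> 0 = PTop"
| "ppow \<phi> (Suc n) = PFus \<phi> (ppow \<phi> n)"

fun psubst :: "(nat \<Rightarrow> 'c pform) \<Rightarrow> 'c pform \<Rightarrow> 'c pform" where
  "psubst \<sigma> (PVar p) = \<sigma> p"
| "psubst \<sigma> PBot = PBot"
| "psubst \<sigma> PTop = PTop"
| "psubst \<sigma> (PAnd \<phi> \<psi>) = PAnd (psubst \<sigma> \<phi>) (psubst \<sigma> \<psi>)"
| "psubst \<sigma> (POr \<phi> \<psi>) = POr (psubst \<sigma> \<phi>) (psubst \<sigma> \<psi>)"
| "psubst \<sigma> (PFus \<phi> \<psi>) = PFus (psubst \<sigma> \<phi>) (psubst \<sigma> \<psi>)"
| "psubst \<sigma> (PImp \<phi> \<psi>) = PImp (psubst \<sigma> \<phi>) (psubst \<sigma> \<psi>)"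
| "psubst \<sigma> (PConn c \<phi>s) = PConn c (map (psubst \<sigma>) \<phi>s)"

fun pvars :: "'c pform \<Rightarrow> nat set" where
  "pvars (PVar p) = {p}"
| "pvars PBot = {}"
| "pvars PTop = {}"
| "pvars (PAnd \<phi> \<psi>) = pvars \<phi> \<union> pvars \<psi>"
| "pvars (POr \<phi> \<psi>) = pvars \<phi> \<union> pvars \<psi>"
| "pvars (PFus \<phi> \<psi>) = pvars \<phi> \<union> pvars \<psi>"
| "pvars (PImp \<phi> \<psi>) = pvars \<phi> \<union> pvars \<psi>"
| "pvars (PConn c \<phi>s) = (\<Union>\<phi>\<in>set \<phi>s. pvars \<phi>)"

text \<open>
  A logic is presented by its connectives beyond those of MTL, axioms, and rules with finitely
  many premises. Axioms and rules are schematic: all their substitution instances may be used.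
\<close>

record 'c logic =
  conns :: "'c set"
  carity :: "'c \<Rightarrow> nat"
  laxioms :: "'c pform set"
  lrules :: "('c pform list \<times> 'c pform) set"

fun pwf :: "'c logic \<Rightarrow> 'c pform \<Rightarrow> bool" where
  "pwf L (PVar p) = True"
| "pwf L PBot = True"
| "pwf L PTop = True"
| "pwf L (PAnd \<phi> \<psi>) = (pwf L \<phi> \<and> pwf L \<psi>)"
| "pwf L (POr \<phi> \<psi>) = (pwf L \<phi> \<and> pwf L \<psi>)"
| "pwf L (PFus \<phi> \<psi>) = (pwf L \<phi> \<and> pwf L \<psi>)"
| "pwf L (PImp \<phi> \<psi>) = (pwf L \<phi> \<and> pwf L \<psi>)"
| "pwf L (PConn c \<phi>s) = (c \<in> conns L \<and> length \<phi>s = carity L c \<and> (\<forall>\<phi>\<in>set \<phi>s. pwf L \<phi>))"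

inductive pderiv :: "'c logic \<Rightarrow> 'c pform set \<Rightarrow> 'c pform \<Rightarrow> bool"
  for L :: "'c logic" and T :: "'c pform set" where
  hyp: "\<phi> \<in> T \<Longrightarrow> pwf L \<phi> \<Longrightarrow> pderiv L T \<phi>"
| ax: "\<alpha> \<in> laxioms L \<Longrightarrow> (\<And>p. pwf L (\<sigma> p)) \<Longrightarrow> pderiv L T (psubst \<sigma> \<alpha>)"
| rl: "(\<Gamma>, \<gamma>) \<in> lrules L \<Longrightarrow> (\<And>p. pwf L (\<sigma> p)) \<Longrightarrow>
       (\<And>\<psi>. \<psi> \<in> set \<Gamma> \<Longrightarrow> pderiv L T (psubst \<sigma> \<psi>)) \<Longrightarrow> pderiv L T (psubst \<sigma> \<gamma>)"

text \<open>
  The Esteva--Godo axioms of MTL; the last two lines are the usual definitions of disjunction and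
  of the constant 1, which are primitive symbols here.
\<close>

definition mtl_axioms :: "'c pform set" where
  "mtl_axioms = (let p = PVar 0; q = PVar 1; r = PVar 2 in
    { PImp (PImp p q) (PImp (PImp q r) (PImp p r)),
      PImp (PFus p q) p,
      PImp (PFus p q) (PFus q p),
      PImp (PAnd p q) p,
      PImp (PAnd p q) (PAnd q p),
      PImp (PFus p (PImp p q)) (PAnd p q),
      PImp (PImp p (PImp q r)) (PImp (PFus p q) r),
      PImp (PImp (PFus p q) r) (PImp p (PImp q r)),
      PImp (PImp (PImp p q) r) (PImp (PImp (PImp q p) r) r),
      PImp PBot p,
      PIff (POr p q) (PAnd (PImp (PImp p q) q) (PImp (PImp q p) p)),
      PIff PTop (PImp PBot PBot) })"

definition MTL :: "'c logic" where
  "MTL = \<lparr> conns = {}, carity = (\<lambda>_. 0), laxioms = mtl_axioms,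
           lrules = {([PVar 0, PImp (PVar 0) (PVar 1)], PVar 1)} \<rparr>"

definition core_fuzzy_logic :: "'c logic \<Rightarrow> bool" where
  "core_fuzzy_logic L \<longleftrightarrow>
     (\<forall>\<alpha>\<in>laxioms L. pwf L \<alpha>) \<and>
     (\<forall>(\<Gamma>, \<gamma>)\<in>lrules L. (\<forall>\<psi>\<in>set \<Gamma>. pwf L \<psi>) \<and> pwf L \<gamma>) \<and>
     (\<forall>T \<phi>. pderiv MTL T \<phi> \<longrightarrow> pderiv L T \<phi>) \<and>
     (\<forall>\<phi> \<psi> \<chi> p. pwf L \<phi> \<longrightarrow> pwf L \<psi> \<longrightarrow> pwf L \<chi> \<longrightarrow>
        pderiv L {PIff \<phi> \<psi>} (PIff (psubst (PVar(p := \<phi>)) \<chi>) (psubst (PVar(p := \<psi>)) \<chi>))) \<and>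
     (\<forall>T \<phi> \<psi>. (\<forall>\<chi>\<in>T. pwf L \<chi>) \<longrightarrow> pwf L \<phi> \<longrightarrow> pwf L \<psi> \<longrightarrow>
        (pderiv L (insert \<phi> T) \<psi> \<longleftrightarrow> (\<exists>n. pderiv L T (PImp (ppow \<phi> n) \<psi>))))"

text \<open>
  The language has no truth-constants besides 0 and 1. Forbidding further nullary connectives is
  not enough: a unary connective \<open>c\<close> could still give rise to a third constant such as
  \<open>c(0)\<close>. Hence every variable-free formula is required to be equivalent to 0 or to 1. This is
  what makes the two-valued Boolean algebra an \<open>L\<close>-algebra, in exactly one way, which maps
  homomorphically to every other \<open>L\<close>-algebra.
\<close>

definition only_constants_0_1 :: "'c logic \<Rightarrow> bool" where
  "only_constants_0_1 L \<longleftrightarrow>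
     (\<forall>c\<in>conns L. carity L c > 0) \<and>
     (\<forall>\<phi>. pwf L \<phi> \<longrightarrow> pvars \<phi> = {} \<longrightarrow>
        pderiv L {} (PIff \<phi> PBot) \<or> pderiv L {} (PIff \<phi> PTop))"


section \<open>Algebras\<close>

record ('a, 'c) algebra =
  carrier :: "'a set"
  meet :: "'a \<Rightarrow> 'a \<Rightarrow> 'a"
  join :: "'a \<Rightarrow> 'a \<Rightarrow> 'a"
  mult :: "'a \<Rightarrow> 'a \<Rightarrow> 'a"
  resid :: "'a \<Rightarrow> 'a \<Rightarrow> 'a"
  zero :: 'a
  one :: 'a
  oper :: "'c \<Rightarrow> 'a list \<Rightarrow> 'a"

definition ale :: "('a, 'c) algebra \<Rightarrow> 'a \<Rightarrow> 'a \<Rightarrow> bool" where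
  "ale A x y \<longleftrightarrow> meet A x y = x"

definition MTL_algebra :: "('a, 'c) algebra \<Rightarrow> bool" where
  "MTL_algebra A \<longleftrightarrow>
     zero A \<in> carrier A \<and> one A \<in> carrier A \<and>
     (\<forall>x\<in>carrier A. \<forall>y\<in>carrier A.
        meet A x y \<in> carrier A \<and> join A x y \<in> carrier A \<and>
        mult A x y \<in> carrier A \<and> resid A x y \<in> carrier A) \<and>
     (\<forall>x\<in>carrier A. \<forall>y\<in>carrier A. \<forall>z\<in>carrier A.
        meet A (meet A x y) z = meet A x (meet A y z) \<and>
        join A (join A x y) z = join A x (join A y z) \<and>
        mult A (mult A x y) z = mult A x (mult A y z) \<and>
        (ale A (mult A x y) z \<longleftrightarrow> ale A x (resid A y z))) \<and>
     (\<forall>x\<in>carrier A. \<forall>y\<in>carrier A.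
        meet A x y = meet A y x \<and> join A x y = join A y x \<and> mult A x y = mult A y x \<and>
        meet A x (join A x y) = x \<and> join A x (meet A x y) = x \<and>
        join A (resid A x y) (resid A y x) = one A) \<and>
     (\<forall>x\<in>carrier A. ale A (zero A) x \<and> ale A x (one A) \<and> mult A (one A) x = x)"

fun pval :: "('a, 'c) algebra \<Rightarrow> (nat \<Rightarrow> 'a) \<Rightarrow> 'c pform \<Rightarrow> 'a" where
  "pval A e (PVar p) = e p"
| "pval A e PBot = zero A"
| "pval A e PTop = one A"
| "pval A e (PAnd \<phi> \<psi>) = meet A (pval A e \<phi>) (pval A e \<psi>)"
| "pval A e (POr \<phi> \<psi>) = join A (pval A e \<phi>) (pval A e \<psi>)"
| "pval A e (PFus \<phi> \<psi>) = mult A (pval A e \<phi>) (pval A e \<psi>)"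
| "pval A e (PImp \<phi> \<psi>) = resid A (pval A e \<phi>) (pval A e \<psi>)"
| "pval A e (PConn c \<phi>s) = oper A c (map (pval A e) \<phi>s)"

definition L_algebra :: "'c logic \<Rightarrow> ('a, 'c) algebra \<Rightarrow> bool" where
  "L_algebra L A \<longleftrightarrow>
     MTL_algebra A \<and>
     (\<forall>c\<in>conns L. \<forall>xs. length xs = carity L c \<longrightarrow> set xs \<subseteq> carrier A \<longrightarrow>
        oper A c xs \<in> carrier A) \<and>
     (\<forall>T \<phi>. pderiv L T \<phi> \<longrightarrow>
        (\<forall>e. (\<forall>p. e p \<in> carrier A) \<longrightarrow> (\<forall>\<psi>\<in>T. pval A e \<psi> = one A) \<longrightarrow> pval A e \<phi> = one A))"

text \<open>
  The operations for additional connectives are read off from \<open>L\<close>: the formula obtained by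
  applying \<open>c\<close> to the constants 0 and 1 is equivalent to one of these constants.
\<close>

definition two :: "'c logic \<Rightarrow> (bool, 'c) algebra" where
  "two L = \<lparr> carrier = UNIV, meet = (\<and>), join = (\<or>), mult = (\<and>), resid = (\<longrightarrow>),
     zero = False, one = True,
     oper = (\<lambda>c bs. pderiv L {} (PConn c (map (\<lambda>b. if b then PTop else PBot) bs))) \<rparr>"


section \<open>Predicate languages and the logic \<open>L\<forall>\<^sup>m\<close>\<close>

type_synonym var = nat

datatype 'f trm = Var var | Fn 'f "'f trm list"

datatype ('f, 'p, 'c) fml =
    Pred 'p "'f trm list" | Bot | Top
  | And "('f, 'p, 'c) fml" "('f, 'p, 'c) fml"
  | Or "('f, 'p, 'c) fml" "('f, 'p, 'c) fml"
  | Fus "('f, 'p, 'c) fml" "('f, 'p, 'c) fml"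
  | Imp "('f, 'p, 'c) fml" "('f, 'p, 'c) fml"
  | Conn 'c "('f, 'p, 'c) fml list"
  | Forall var "('f, 'p, 'c) fml"
  | Exists var "('f, 'p, 'c) fml"

definition Iff :: "('f, 'p, 'c) fml \<Rightarrow> ('f, 'p, 'c) fml \<Rightarrow> ('f, 'p, 'c) fml" where
  "Iff \<phi> \<psi> = Fus (Imp \<phi> \<psi>) (Imp \<psi> \<phi>)"

record ('f, 'p) language =
  funs :: "'f set"
  preds :: "'p set"
  farity :: "'f \<Rightarrow> nat"
  parity :: "'p \<Rightarrow> nat"
  sim :: 'p

definition similarity_language :: "('f, 'p) language \<Rightarrow> bool" where
  "similarity_language \<Sigma> \<longleftrightarrow> sim \<Sigma> \<in> preds \<Sigma> \<and> parity \<Sigma> (sim \<Sigma>) = 2"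

fun twf :: "('f, 'p) language \<Rightarrow> 'f trm \<Rightarrow> bool" where
  "twf \<Sigma> (Var x) = True"
| "twf \<Sigma> (Fn F ts) = (F \<in> funs \<Sigma> \<and> length ts = farity \<Sigma> F \<and> (\<forall>t\<in>set ts. twf \<Sigma> t))"

fun fwf :: "'c logic \<Rightarrow> ('f, 'p) language \<Rightarrow> ('f, 'p, 'c) fml \<Rightarrow> bool" where
  "fwf L \<Sigma> (Pred P ts) = (P \<in> preds \<Sigma> \<and> length ts = parity \<Sigma> P \<and> (\<forall>t\<in>set ts. twf \<Sigma> t))"
| "fwf L \<Sigma> Bot = True"
| "fwf L \<Sigma> Top = True"
| "fwf L \<Sigma> (And \<phi> \<psi>) = (fwf L \<Sigma> \<phi> \<and> fwf L \<Sigma> \<psi>)"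
| "fwf L \<Sigma> (Or \<phi> \<psi>) = (fwf L \<Sigma> \<phi> \<and> fwf L \<Sigma> \<psi>)"
| "fwf L \<Sigma> (Fus \<phi> \<psi>) = (fwf L \<Sigma> \<phi> \<and> fwf L \<Sigma> \<psi>)"
| "fwf L \<Sigma> (Imp \<phi> \<psi>) = (fwf L \<Sigma> \<phi> \<and> fwf L \<Sigma> \<psi>)"
| "fwf L \<Sigma> (Conn c \<phi>s) = (c \<in> conns L \<and> length \<phi>s = carity L c \<and> (\<forall>\<phi>\<in>set \<phi>s. fwf L \<Sigma> \<phi>))"
| "fwf L \<Sigma> (Forall x \<phi>) = fwf L \<Sigma> \<phi>"
| "fwf L \<Sigma> (Exists x \<phi>) = fwf L \<Sigma> \<phi>"

fun tvars :: "'f trm \<Rightarrow> var set" where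
  "tvars (Var x) = {x}"
| "tvars (Fn F ts) = (\<Union>t\<in>set ts. tvars t)"

fun fv :: "('f, 'p, 'c) fml \<Rightarrow> var set" where
  "fv (Pred P ts) = (\<Union>t\<in>set ts. tvars t)"
| "fv Bot = {}"
| "fv Top = {}"
| "fv (And \<phi> \<psi>) = fv \<phi> \<union> fv \<psi>"
| "fv (Or \<phi> \<psi>) = fv \<phi> \<union> fv \<psi>"
| "fv (Fus \<phi> \<psi>) = fv \<phi> \<union> fv \<psi>"
| "fv (Imp \<phi> \<psi>) = fv \<phi> \<union> fv \<psi>"
| "fv (Conn c \<phi>s) = (\<Union>\<phi>\<in>set \<phi>s. fv \<phi>)"
| "fv (Forall x \<phi>) = fv \<phi> - {x}"
| "fv (Exists x \<phi>) = fv \<phi> - {x}"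

fun tsubst :: "var \<Rightarrow> 'f trm \<Rightarrow> 'f trm \<Rightarrow> 'f trm" where
  "tsubst x t (Var y) = (if y = x then t else Var y)"
| "tsubst x t (Fn F ts) = Fn F (map (tsubst x t) ts)"

fun fsubst :: "var \<Rightarrow> 'f trm \<Rightarrow> ('f, 'p, 'c) fml \<Rightarrow> ('f, 'p, 'c) fml" where
  "fsubst x t (Pred P ts) = Pred P (map (tsubst x t) ts)"
| "fsubst x t Bot = Bot"
| "fsubst x t Top = Top"
| "fsubst x t (And \<phi> \<psi>) = And (fsubst x t \<phi>) (fsubst x t \<psi>)"
| "fsubst x t (Or \<phi> \<psi>) = Or (fsubst x t \<phi>) (fsubst x t \<psi>)"
| "fsubst x t (Fus \<phi> \<psi>) = Fus (fsubst x t \<phi>) (fsubst x t \<psi>)"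
| "fsubst x t (Imp \<phi> \<psi>) = Imp (fsubst x t \<phi>) (fsubst x t \<psi>)"
| "fsubst x t (Conn c \<phi>s) = Conn c (map (fsubst x t) \<phi>s)"
| "fsubst x t (Forall y \<phi>) = Forall y (if y = x then \<phi> else fsubst x t \<phi>)"
| "fsubst x t (Exists y \<phi>) = Exists y (if y = x then \<phi> else fsubst x t \<phi>)"

fun substitutable :: "var \<Rightarrow> 'f trm \<Rightarrow> ('f, 'p, 'c) fml \<Rightarrow> bool" where
  "substitutable x t (Pred P ts) = True"
| "substitutable x t Bot = True"
| "substitutable x t Top = True"
| "substitutable x t (And \<phi> \<psi>) = (substitutable x t \<phi> \<and> substitutable x t \<psi>)"
| "substitutable x t (Or \<phi> \<psi>) = (substitutable x t \<phi> \<and> substitutable x t \<psi>)"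
| "substitutable x t (Fus \<phi> \<psi>) = (substitutable x t \<phi> \<and> substitutable x t \<psi>)"
| "substitutable x t (Imp \<phi> \<psi>) = (substitutable x t \<phi> \<and> substitutable x t \<psi>)"
| "substitutable x t (Conn c \<phi>s) = (\<forall>\<phi>\<in>set \<phi>s. substitutable x t \<phi>)"
| "substitutable x t (Forall y \<phi>) =
     (x \<notin> fv (Forall y \<phi>) \<or> (y \<notin> tvars t \<and> substitutable x t \<phi>))"
| "substitutable x t (Exists y \<phi>) =
     (x \<notin> fv (Exists y \<phi>) \<or> (y \<notin> tvars t \<and> substitutable x t \<phi>))"

fun instance_of :: "(nat \<Rightarrow> ('f, 'p, 'c) fml) \<Rightarrow> 'c pform \<Rightarrow> ('f, 'p, 'c) fml" where
  "instance_of \<sigma> (PVar p) = \<sigma> p"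
| "instance_of \<sigma> PBot = Bot"
| "instance_of \<sigma> PTop = Top"
| "instance_of \<sigma> (PAnd \<phi> \<psi>) = And (instance_of \<sigma> \<phi>) (instance_of \<sigma> \<psi>)"
| "instance_of \<sigma> (POr \<phi> \<psi>) = Or (instance_of \<sigma> \<phi>) (instance_of \<sigma> \<psi>)"
| "instance_of \<sigma> (PFus \<phi> \<psi>) = Fus (instance_of \<sigma> \<phi>) (instance_of \<sigma> \<psi>)"
| "instance_of \<sigma> (PImp \<phi> \<psi>) = Imp (instance_of \<sigma> \<phi>) (instance_of \<sigma> \<psi>)"
| "instance_of \<sigma> (PConn c \<phi>s) = Conn c (map (instance_of \<sigma>) \<phi>s)"

definition simeq :: "('f, 'p) language \<Rightarrow> 'f trm \<Rightarrow> 'f trm \<Rightarrow> ('f, 'p, 'c) fml" where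
  "simeq \<Sigma> s t = Pred (sim \<Sigma>) [s, t]"

fun big_fus :: "('f, 'p, 'c) fml list \<Rightarrow> ('f, 'p, 'c) fml" where
  "big_fus [] = Top"
| "big_fus [\<phi>] = \<phi>"
| "big_fus (\<phi> # \<psi> # \<phi>s) = Fus \<phi> (big_fus (\<psi> # \<phi>s))"

definition pairwise_sim ::
    "('f, 'p) language \<Rightarrow> var list \<Rightarrow> var list \<Rightarrow> ('f, 'p, 'c) fml" where
  "pairwise_sim \<Sigma> xs ys = big_fus (map2 (\<lambda>x y. simeq \<Sigma> (Var x) (Var y)) xs ys)"

text \<open>
  The variables in the similarity axioms are metavariables: there is one axiom for every choice
  of pairwise distinct variables.
\<close>

inductive_set sim_axioms :: "('f, 'p) language \<Rightarrow> ('f, 'p, 'c) fml set"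
  for \<Sigma> :: "('f, 'p) language" where
  refl: "Forall x (simeq \<Sigma> (Var x) (Var x)) \<in> sim_axioms \<Sigma>"
| sym: "distinct [x, y] \<Longrightarrow>
    Forall x (Forall y (Imp (simeq \<Sigma> (Var x) (Var y)) (simeq \<Sigma> (Var y) (Var x)))) \<in> sim_axioms \<Sigma>"
| trans: "distinct [x, y, z] \<Longrightarrow>
    Forall x (Forall y (Forall z
      (Imp (Fus (simeq \<Sigma> (Var x) (Var y)) (simeq \<Sigma> (Var y) (Var z)))
        (simeq \<Sigma> (Var x) (Var z))))) \<in> sim_axioms \<Sigma>"
| func: "F \<in> funs \<Sigma> \<Longrightarrow> length xs = farity \<Sigma> F \<Longrightarrow> length ys = farity \<Sigma> F \<Longrightarrow> distinct (xs @ ys) \<Longrightarrow>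
    foldr Forall (xs @ ys)
      (Imp (pairwise_sim \<Sigma> xs ys) (simeq \<Sigma> (Fn F (map Var xs)) (Fn F (map Var ys)))) \<in> sim_axioms \<Sigma>"
| pred: "P \<in> preds \<Sigma> \<Longrightarrow> length xs = parity \<Sigma> P \<Longrightarrow> length ys = parity \<Sigma> P \<Longrightarrow> distinct (xs @ ys) \<Longrightarrow>
    foldr Forall (xs @ ys)
      (Imp (pairwise_sim \<Sigma> xs ys) (Iff (Pred P (map Var xs)) (Pred P (map Var ys)))) \<in> sim_axioms \<Sigma>"

text \<open>
  As members of \<open>\<Phi>\<close> may have free variables, whose values are fixed by an evaluation,
  generalization over \<open>x\<close> is restricted as usual for derivations from open hypotheses:
  \<open>x\<close> must not be free in the hypotheses \<open>\<Psi>\<close> used to derive the premise. The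
  restriction is void if \<open>\<Phi>\<close> consists of sentences. Without it, \<open>P(x)\<close> would prove
  \<open>P(y)\<close>, and provability would not be sound for models given with an evaluation.
\<close>

inductive prv ::
    "'c logic \<Rightarrow> ('f, 'p) language \<Rightarrow> ('f, 'p, 'c) fml set \<Rightarrow> ('f, 'p, 'c) fml \<Rightarrow> bool"
  for L :: "'c logic" and \<Sigma> :: "('f, 'p) language" where
  hyp: "\<phi> \<in> \<Phi> \<Longrightarrow> fwf L \<Sigma> \<phi> \<Longrightarrow> prv L \<Sigma> \<Phi> \<phi>"
| ax: "\<alpha> \<in> laxioms L \<Longrightarrow> (\<And>p. fwf L \<Sigma> (\<sigma> p)) \<Longrightarrow> prv L \<Sigma> \<Phi> (instance_of \<sigma> \<alpha>)"
| forall1: "fwf L \<Sigma> \<phi> \<Longrightarrow> twf \<Sigma> t \<Longrightarrow> substitutable x t \<phi> \<Longrightarrow>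
    prv L \<Sigma> \<Phi> (Imp (Forall x \<phi>) (fsubst x t \<phi>))"
| exists1: "fwf L \<Sigma> \<phi> \<Longrightarrow> twf \<Sigma> t \<Longrightarrow> substitutable x t \<phi> \<Longrightarrow>
    prv L \<Sigma> \<Phi> (Imp (fsubst x t \<phi>) (Exists x \<phi>))"
| forall2: "fwf L \<Sigma> \<xi> \<Longrightarrow> fwf L \<Sigma> \<phi> \<Longrightarrow> x \<notin> fv \<xi> \<Longrightarrow>
    prv L \<Sigma> \<Phi> (Imp (Forall x (Imp \<xi> \<phi>)) (Imp \<xi> (Forall x \<phi>)))"
| exists2: "fwf L \<Sigma> \<xi> \<Longrightarrow> fwf L \<Sigma> \<phi> \<Longrightarrow> x \<notin> fv \<xi> \<Longrightarrow>
    prv L \<Sigma> \<Phi> (Imp (Forall x (Imp \<phi> \<xi>)) (Imp (Exists x \<phi>) \<xi>))"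
| similarity: "\<alpha> \<in> sim_axioms \<Sigma> \<Longrightarrow> prv L \<Sigma> \<Phi> \<alpha>"
| rl: "(\<Gamma>, \<gamma>) \<in> lrules L \<Longrightarrow> (\<And>p. fwf L \<Sigma> (\<sigma> p)) \<Longrightarrow>
    (\<And>\<psi>. \<psi> \<in> set \<Gamma> \<Longrightarrow> prv L \<Sigma> \<Phi> (instance_of \<sigma> \<psi>)) \<Longrightarrow> prv L \<Sigma> \<Phi> (instance_of \<sigma> \<gamma>)"
| gen: "prv L \<Sigma> \<Psi> \<phi> \<Longrightarrow> \<Psi> \<subseteq> \<Phi> \<Longrightarrow> (\<And>\<psi>. \<psi> \<in> \<Psi> \<Longrightarrow> x \<notin> fv \<psi>) \<Longrightarrow> prv L \<Sigma> \<Phi> (Forall x \<phi>)"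

definition consistent ::
    "'c logic \<Rightarrow> ('f, 'p) language \<Rightarrow> ('f, 'p, 'c) fml set \<Rightarrow> bool" where
  "consistent L \<Sigma> \<Phi> \<longleftrightarrow> \<not> prv L \<Sigma> \<Phi> Bot"


section \<open>Semantics\<close>

record ('m, 'f, 'p, 'a) struct =
  univ :: "'m set"
  fint :: "'f \<Rightarrow> 'm list \<Rightarrow> 'm"
  pint :: "'p \<Rightarrow> 'm list \<Rightarrow> 'a"

definition A_structure ::
    "('f, 'p) language \<Rightarrow> ('a, 'c) algebra \<Rightarrow> ('m, 'f, 'p, 'a) struct \<Rightarrow> bool" where
  "A_structure \<Sigma> A M \<longleftrightarrow>
     univ M \<noteq> {} \<and>
     (\<forall>F\<in>funs \<Sigma>. \<forall>ds. length ds = farity \<Sigma> F \<longrightarrow> set ds \<subseteq> univ M \<longrightarrow> fint M F ds \<in> univ M) \<and>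
     (\<forall>P\<in>preds \<Sigma>. \<forall>ds. length ds = parity \<Sigma> P \<longrightarrow> set ds \<subseteq> univ M \<longrightarrow> pint M P ds \<in> carrier A)"

definition evaluation :: "('m, 'f, 'p, 'a) struct \<Rightarrow> (var \<Rightarrow> 'm) \<Rightarrow> bool" where
  "evaluation M v \<longleftrightarrow> (\<forall>x. v x \<in> univ M)"

definition is_inf :: "('a, 'c) algebra \<Rightarrow> 'a set \<Rightarrow> 'a \<Rightarrow> bool" where
  "is_inf A X m \<longleftrightarrow> m \<in> carrier A \<and> (\<forall>x\<in>X. ale A m x) \<and>
     (\<forall>l\<in>carrier A. (\<forall>x\<in>X. ale A l x) \<longrightarrow> ale A l m)"

definition is_sup :: "('a, 'c) algebra \<Rightarrow> 'a set \<Rightarrow> 'a \<Rightarrow> bool" where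
  "is_sup A X m \<longleftrightarrow> m \<in> carrier A \<and> (\<forall>x\<in>X. ale A x m) \<and>
     (\<forall>u\<in>carrier A. (\<forall>x\<in>X. ale A x u) \<longrightarrow> ale A m u)"

text \<open>
  \<^const>\<open>None\<close> stands for an undefined truth value. An infimum or supremum is undefined if it
  does not exist or if one of the values involved is undefined.
\<close>

definition inf_value :: "('a, 'c) algebra \<Rightarrow> 'a option set \<Rightarrow> 'a option" where
  "inf_value A V = (if None \<notin> V \<and> (\<exists>m. is_inf A (Option.these V) m)
     then Some (THE m. is_inf A (Option.these V) m) else None)"

definition sup_value :: "('a, 'c) algebra \<Rightarrow> 'a option set \<Rightarrow> 'a option" where
  "sup_value A V = (if None \<notin> V \<and> (\<exists>m. is_sup A (Option.these V) m)
     then Some (THE m. is_sup A (Option.these V) m) else None)"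

definition lift2 :: "('a \<Rightarrow> 'a \<Rightarrow> 'a) \<Rightarrow> 'a option \<Rightarrow> 'a option \<Rightarrow> 'a option" where
  "lift2 f x y = Option.bind x (\<lambda>a. map_option (f a) y)"

fun tval :: "('m, 'f, 'p, 'a) struct \<Rightarrow> (var \<Rightarrow> 'm) \<Rightarrow> 'f trm \<Rightarrow> 'm" where
  "tval M v (Var x) = v x"
| "tval M v (Fn F ts) = fint M F (map (tval M v) ts)"

fun fval :: "('a, 'c) algebra \<Rightarrow> ('m, 'f, 'p, 'a) struct \<Rightarrow> (var \<Rightarrow> 'm) \<Rightarrow>
    ('f, 'p, 'c) fml \<Rightarrow> 'a option" where
  "fval A M v (Pred P ts) = Some (pint M P (map (tval M v) ts))"
| "fval A M v Bot = Some (zero A)"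
| "fval A M v Top = Some (one A)"
| "fval A M v (And \<phi> \<psi>) = lift2 (meet A) (fval A M v \<phi>) (fval A M v \<psi>)"
| "fval A M v (Or \<phi> \<psi>) = lift2 (join A) (fval A M v \<phi>) (fval A M v \<psi>)"
| "fval A M v (Fus \<phi> \<psi>) = lift2 (mult A) (fval A M v \<phi>) (fval A M v \<psi>)"
| "fval A M v (Imp \<phi> \<psi>) = lift2 (resid A) (fval A M v \<phi>) (fval A M v \<psi>)"
| "fval A M v (Conn c \<phi>s) = map_option (oper A c) (those (map (fval A M v) \<phi>s))"
| "fval A M v (Forall x \<phi>) = inf_value A ((\<lambda>d. fval A M (v(x := d)) \<phi>) ` univ M)"
| "fval A M v (Exists x \<phi>) = sup_value A ((\<lambda>d. fval A M (v(x := d)) \<phi>) ` univ M)"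

definition safe :: "'c logic \<Rightarrow> ('f, 'p) language \<Rightarrow> ('a, 'c) algebra \<Rightarrow>
    ('m, 'f, 'p, 'a) struct \<Rightarrow> bool" where
  "safe L \<Sigma> A M \<longleftrightarrow>
     (\<forall>\<phi> v. fwf L \<Sigma> \<phi> \<longrightarrow> evaluation M v \<longrightarrow> fval A M v \<phi> \<noteq> None)"

definition models :: "('a, 'c) algebra \<Rightarrow> ('m, 'f, 'p, 'a) struct \<Rightarrow> (var \<Rightarrow> 'm) \<Rightarrow>
    ('f, 'p, 'c) fml set \<Rightarrow> bool" where
  "models A M v \<Phi> \<longleftrightarrow> (\<forall>\<phi>\<in>\<Phi>. fval A M v \<phi> = Some (one A))"

definition is_structure :: "'c logic \<Rightarrow> ('f, 'p) language \<Rightarrow> ('a, 'c) algebra \<Rightarrow>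
    ('m, 'f, 'p, 'a) struct \<Rightarrow> bool" where
  "is_structure L \<Sigma> A M \<longleftrightarrow>
     L_algebra L A \<and> A_structure \<Sigma> A M \<and> safe L \<Sigma> A M \<and>
     (\<forall>v. evaluation M v \<longrightarrow> models A M v (sim_axioms \<Sigma>))"

definition reduced :: "('f, 'p) language \<Rightarrow> ('a, 'c) algebra \<Rightarrow>
    ('m, 'f, 'p, 'a) struct \<Rightarrow> bool" where
  "reduced \<Sigma> A M \<longleftrightarrow>
     (\<forall>d\<in>univ M. \<forall>e\<in>univ M. pint M (sim \<Sigma>) [d, e] = one A \<longleftrightarrow> d = e)"

definition reduced_model :: "'c logic \<Rightarrow> ('f, 'p) language \<Rightarrow> ('f, 'p, 'c) fml set \<Rightarrow>
    ('a, 'c) algebra \<Rightarrow> ('m, 'f, 'p, 'a) struct \<Rightarrow> (var \<Rightarrow> 'm) \<Rightarrow> bool" where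
  "reduced_model L \<Sigma> \<Phi> A M v \<longleftrightarrow>
     is_structure L \<Sigma> A M \<and> reduced \<Sigma> A M \<and> evaluation M v \<and> models A M v \<Phi>"

text \<open>
  Maps between carriers are represented by extensional functions, so that equality of
  homomorphisms is equality of their values on the carriers.
\<close>

definition algebra_hom :: "'c logic \<Rightarrow> ('a, 'c) algebra \<Rightarrow> ('b, 'c) algebra \<Rightarrow>
    ('a \<Rightarrow> 'b) \<Rightarrow> bool" where
  "algebra_hom L A C f \<longleftrightarrow>
     f \<in> carrier A \<rightarrow>\<^sub>E carrier C \<and>
     f (zero A) = zero C \<and> f (one A) = one C \<and>
     (\<forall>x\<in>carrier A. \<forall>y\<in>carrier A.
        f (meet A x y) = meet C (f x) (f y) \<and> f (join A x y) = join C (f x) (f y) \<and>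
        f (mult A x y) = mult C (f x) (f y) \<and> f (resid A x y) = resid C (f x) (f y)) \<and>
     (\<forall>c\<in>conns L. \<forall>xs. length xs = carity L c \<longrightarrow> set xs \<subseteq> carrier A \<longrightarrow>
        f (oper A c xs) = oper C c (map f xs))"

definition homomorphism :: "'c logic \<Rightarrow> ('f, 'p) language \<Rightarrow>
    ('a, 'c) algebra \<Rightarrow> ('m, 'f, 'p, 'a) struct \<Rightarrow>
    ('b, 'c) algebra \<Rightarrow> ('n, 'f, 'p, 'b) struct \<Rightarrow> ('a \<Rightarrow> 'b) \<Rightarrow> ('m \<Rightarrow> 'n) \<Rightarrow> bool" where
  "homomorphism L \<Sigma> A M C N f g \<longleftrightarrow>
     algebra_hom L A C f \<and> g \<in> univ M \<rightarrow>\<^sub>E univ N \<and>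
     (\<forall>F\<in>funs \<Sigma>. \<forall>ds. length ds = farity \<Sigma> F \<longrightarrow> set ds \<subseteq> univ M \<longrightarrow>
        g (fint M F ds) = fint N F (map g ds)) \<and>
     (\<forall>P\<in>preds \<Sigma>. \<forall>ds. length ds = parity \<Sigma> P \<longrightarrow> set ds \<subseteq> univ M \<longrightarrow>
        pint M P ds = one A \<longrightarrow> pint N P (map g ds) = one C)"


section \<open>The term structure\<close>

definition tclass :: "'c logic \<Rightarrow> ('f, 'p) language \<Rightarrow> ('f, 'p, 'c) fml set \<Rightarrow>
    'f trm \<Rightarrow> 'f trm set" where
  "tclass L \<Sigma> \<Phi> t = {s. twf \<Sigma> s \<and> prv L \<Sigma> \<Phi> (simeq \<Sigma> t s)}"

text \<open>
  Functions and predicates on classes are defined through representatives; provable congruence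
  of \<open>\<approx>\<close> makes the result independent of the choice.
\<close>

definition representatives :: "'c logic \<Rightarrow> ('f, 'p) language \<Rightarrow> ('f, 'p, 'c) fml set \<Rightarrow>
    'f trm set list \<Rightarrow> 'f trm list \<Rightarrow> bool" where
  "representatives L \<Sigma> \<Phi> cs ts \<longleftrightarrow> (\<forall>t\<in>set ts. twf \<Sigma> t) \<and> map (tclass L \<Sigma> \<Phi>) ts = cs"

definition term_structure :: "'c logic \<Rightarrow> ('f, 'p) language \<Rightarrow> ('f, 'p, 'c) fml set \<Rightarrow>
    ('f trm set, 'f, 'p, bool) struct" where
  "term_structure L \<Sigma> \<Phi> = \<lparr>
     univ = tclass L \<Sigma> \<Phi> ` {t. twf \<Sigma> t},
     fint = (\<lambda>F cs. THE c. \<exists>ts. representatives L \<Sigma> \<Phi> cs ts \<and> c = tclass L \<Sigma> \<Phi> (Fn F ts)),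
     pint = (\<lambda>P cs. \<exists>ts. representatives L \<Sigma> \<Phi> cs ts \<and> prv L \<Sigma> \<Phi> (Pred P ts)) \<rparr>"

definition canonical_evaluation :: "'c logic \<Rightarrow> ('f, 'p) language \<Rightarrow> ('f, 'p, 'c) fml set \<Rightarrow>
    var \<Rightarrow> 'f trm set" where
  "canonical_evaluation L \<Sigma> \<Phi> x = tclass L \<Sigma> \<Phi> (Var x)"

end

theory Submission
  imports Defs
begin

text \<open>
  Every variable-free formula of \<open>L\<close> is equivalent to 0 or to 1, so a formula holds in the
  two-valued algebra under an evaluation iff it is derivable after its variables have been replaced by
  the corresponding constants. Hence the two-valued algebra is an \<open>L\<close>-algebra, and sending its
  elements to 0 and 1 is a homomorphism into every \<open>L\<close>-algebra. Given a reduced model, the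
  class of a term can only be sent to the value of the term. Soundness shows that provably similar
  terms have similar values, which are equal as the model is reduced, and that provable atomic
  formulas have value 1.
\<close>

section \<open>Derivability in a core fuzzy logic\<close>

text \<open>The extra operations of \<open>two L\<close> are read off from derivability in
  \<open>L\<close>, so they cannot be compared with the axioms of \<open>L\<close> by a direct
  computation: truth has first to be reduced to derivability. The delicate point is a nested
  connective, whose arguments must be replaced by the constants equivalent to them; the congruence
  property allows this. Derivability separates the two constants only if 0 is underivable in
  \<open>L\<close>. This comes from the consistency of \<open>\<Phi>\<close>, since a propositional
  derivation of 0 would also be a proof of 0 from \<open>\<Phi>\<close>. On the first-order side, a
  similarity axiom has a whole prefix of quantifiers, while the instantiation axiom handles one
  variable at a time. Passing to arbitrary terms therefore needs control of capture, and of terms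
  that mention variables still to be instantiated. Soundness concerns a fixed evaluation of possibly
  open hypotheses, which is what the side condition of generalization protects.\<close>

lemma psubst_PVar [simp]: "psubst PVar \<phi> = \<phi>"
  by (induction \<phi>) (auto intro: map_idI)

lemma psubst_psubst: "psubst \<tau> (psubst \<sigma> \<phi>) = psubst (\<lambda>p. psubst \<tau> (\<sigma> p)) \<phi>"
  by (induction \<phi>) auto

lemma psubst_closed: "pvars \<phi> = {} \<Longrightarrow> psubst \<sigma> \<phi> = \<phi>"
  by (induction \<phi>) (auto intro: map_idI)

lemma pvars_psubst: "pvars (psubst \<sigma> \<phi>) = (\<Union>p\<in>pvars \<phi>. pvars (\<sigma> p))"
  by (induction \<phi>) auto

lemma pwf_psubst: "pwf L \<phi> \<Longrightarrow> (\<And>p. pwf L (\<sigma> p)) \<Longrightarrow> pwf L (psubst \<sigma> \<phi>)"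
  by (induction \<phi>) auto

lemma instance_of_psubst:
  "instance_of \<tau> (psubst \<sigma> \<phi>) = instance_of (\<lambda>p. instance_of \<tau> (\<sigma> p)) \<phi>"
  by (induction \<phi>) auto

lemma fwf_instance_of: "pwf L \<phi> \<Longrightarrow> (\<And>p. fwf L \<Sigma> (\<sigma> p)) \<Longrightarrow> fwf L \<Sigma> (instance_of \<sigma> \<phi>)"
  by (induction \<phi>) auto

text \<open>Axioms and rules are schematic, so composing their substitutions with
  \<open>\<sigma>\<close> turns a derivation into a derivation, and other derivations can be grafted
  onto its hypotheses. With \<open>PVar\<close> for \<open>\<sigma>\<close> this is cut; with empty
  \<open>T\<close> it is closure under substitution.\<close>

lemma pderiv_cut:
  assumes "pderiv L T \<phi>" and "\<And>p. pwf L (\<sigma> p)" and "\<And>\<psi>. \<psi> \<in> T \<Longrightarrow> pderiv L U (psubst \<sigma> \<psi>)"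
  shows "pderiv L U (psubst \<sigma> \<phi>)"
  using assms(1)
proof induction
  case (hyp \<phi>)
  then show ?case using assms(3) by blast
next
  case (ax \<alpha> \<tau>)
  then show ?case
    using assms(2) by (simp add: psubst_psubst pderiv.ax pwf_psubst)
next
  case (rl \<Gamma> \<gamma> \<tau>)
  then show ?case
    using assms(2) by (simp add: psubst_psubst pderiv.rl[of \<Gamma>] pwf_psubst)
qed

text \<open>The same grafting, now into first-order proofs: a first-order instance of a substitution
  instance is again a first-order instance. All propositional reasoning inside \<open>prv\<close> is
  imported through this lemma.\<close>

lemma pderiv_imp_prv:
  assumes "pderiv L T \<phi>" and "\<And>p. fwf L \<Sigma> (\<sigma> p)"
    and "\<And>\<psi>. \<psi> \<in> T \<Longrightarrow> prv L \<Sigma> \<Phi> (instance_of \<sigma> \<psi>)"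
  shows "prv L \<Sigma> \<Phi> (instance_of \<sigma> \<phi>)"
  using assms(1)
proof induction
  case (hyp \<phi>)
  then show ?case using assms(3) by blast
next
  case (ax \<alpha> \<tau>)
  then show ?case
    using assms(2) by (simp add: instance_of_psubst prv.ax fwf_instance_of)
next
  case (rl \<Gamma> \<gamma> \<tau>)
  then show ?case
    using assms(2) by (simp add: instance_of_psubst prv.rl[of \<Gamma>] fwf_instance_of)
qed

text \<open>The MTL axioms and modus ponens mention at most three variables. The remaining ones get
  the third value, so that the substitution is well-formed everywhere.\<close>

definition assign3 :: "'a \<Rightarrow> 'a \<Rightarrow> 'a \<Rightarrow> nat \<Rightarrow> 'a" where
  "assign3 a b c n = (if n = 0 then a else if n = 1 then b else c)"

lemma assign3_simps [simp]:
  "assign3 a b c 0 = a" "assign3 a b c (Suc 0) = b" "assign3 a b c 2 = c"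
  by (auto simp: assign3_def)

section \<open>Derived rules of MTL, available in every core fuzzy logic\<close>

locale core_logic =
  fixes L :: "'c logic"
  assumes core: "core_fuzzy_logic L"
begin

lemma axiom_pwf: "\<alpha> \<in> laxioms L \<Longrightarrow> pwf L \<alpha>"
  and rule_pwf: "(\<Gamma>, \<gamma>) \<in> lrules L \<Longrightarrow> (\<forall>\<psi>\<in>set \<Gamma>. pwf L \<psi>) \<and> pwf L \<gamma>"
  and MTL_pderiv: "pderiv MTL T \<phi> \<Longrightarrow> pderiv L T \<phi>"
  and congruence: "pwf L \<phi> \<Longrightarrow> pwf L \<psi> \<Longrightarrow> pwf L \<chi> \<Longrightarrow>
    pderiv L {PIff \<phi> \<psi>} (PIff (psubst (PVar(p := \<phi>)) \<chi>) (psubst (PVar(p := \<psi>)) \<chi>))"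
proof -
  note c = core[unfolded core_fuzzy_logic_def]
  show "\<alpha> \<in> laxioms L \<Longrightarrow> pwf L \<alpha>"
    using c[THEN conjunct1] by blast
  show "(\<Gamma>, \<gamma>) \<in> lrules L \<Longrightarrow> (\<forall>\<psi>\<in>set \<Gamma>. pwf L \<psi>) \<and> pwf L \<gamma>"
    using c[THEN conjunct2, THEN conjunct1] by fast
  show "pderiv MTL T \<phi> \<Longrightarrow> pderiv L T \<phi>"
    using c[THEN conjunct2, THEN conjunct2, THEN conjunct1] by blast
  show "pwf L \<phi> \<Longrightarrow> pwf L \<psi> \<Longrightarrow> pwf L \<chi> \<Longrightarrow>
    pderiv L {PIff \<phi> \<psi>} (PIff (psubst (PVar(p := \<phi>)) \<chi>) (psubst (PVar(p := \<psi>)) \<chi>))"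
    using c[THEN conjunct2, THEN conjunct2, THEN conjunct2, THEN conjunct1] by blast
qed

lemma pderiv_pwf: "pderiv L T \<phi> \<Longrightarrow> pwf L \<phi>"
  by (induction rule: pderiv.induct) (auto intro: pwf_psubst dest: axiom_pwf rule_pwf)

text \<open>\<open>L\<close> extends the consequence relation of MTL, but its own axioms may differ.
  Instances with extra connectives are not formulas of MTL, so the bare schema is derived there,
  imported, and substituted only afterwards.\<close>

lemma mtl_axiom:
  assumes "\<alpha> \<in> mtl_axioms" and "\<And>p. pwf L (\<sigma> p)"
  shows "pderiv L T (psubst \<sigma> \<alpha>)"
proof -
  have "pderiv MTL {} (psubst PVar \<alpha>)"
    by (rule pderiv.ax) (use assms in \<open>auto simp: MTL_def\<close>)
  then show ?thesis
    using assms(2) by (intro pderiv_cut[of L "{}" \<alpha>]) (auto intro: MTL_pderiv)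
qed

lemma mtl_instance:
  assumes "\<alpha> \<in> mtl_axioms" and "pwf L \<phi>" "pwf L \<psi>" "pwf L \<chi>"
  shows "pderiv L T (psubst (assign3 \<phi> \<psi> \<chi>) \<alpha>)"
  using assms by (intro mtl_axiom) (auto simp: assign3_def)

lemma
  assumes "pwf L \<phi>" "pwf L \<psi>" "pwf L \<chi>"
  shows suffixing: "pderiv L T (PImp (PImp \<phi> \<psi>) (PImp (PImp \<psi> \<chi>) (PImp \<phi> \<chi>)))"
    and exportation: "pderiv L T (PImp (PImp (PFus \<phi> \<psi>) \<chi>) (PImp \<phi> (PImp \<psi> \<chi>)))"
  using assms
    mtl_instance[OF _ assms, of "PImp (PImp (PVar 0) (PVar 1))
      (PImp (PImp (PVar 1) (PVar 2)) (PImp (PVar 0) (PVar 2)))"]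
    mtl_instance[OF _ assms, of "PImp (PImp (PFus (PVar 0) (PVar 1)) (PVar 2))
      (PImp (PVar 0) (PImp (PVar 1) (PVar 2)))"]
  by (simp_all add: mtl_axioms_def Let_def)

lemma
  assumes "pwf L \<phi>" "pwf L \<psi>"
  shows fus_left: "pderiv L T (PImp (PFus \<phi> \<psi>) \<phi>)"
    and fus_comm: "pderiv L T (PImp (PFus \<phi> \<psi>) (PFus \<psi> \<phi>))"
    and and_left: "pderiv L T (PImp (PAnd \<phi> \<psi>) \<phi>)"
    and and_comm: "pderiv L T (PImp (PAnd \<phi> \<psi>) (PAnd \<psi> \<phi>))"
    and divisibility: "pderiv L T (PImp (PFus \<phi> (PImp \<phi> \<psi>)) (PAnd \<phi> \<psi>))"
    and or_iff: "pderiv L T (PIff (POr \<phi> \<psi>)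
      (PAnd (PImp (PImp \<phi> \<psi>) \<psi>) (PImp (PImp \<psi> \<phi>) \<phi>)))"
  using assms mtl_instance[OF _ assms assms(2), of "PImp (PFus (PVar 0) (PVar 1)) (PVar 0)"]
    mtl_instance[OF _ assms assms(2), of "PImp (PFus (PVar 0) (PVar 1)) (PFus (PVar 1) (PVar 0))"]
    mtl_instance[OF _ assms assms(2), of "PImp (PAnd (PVar 0) (PVar 1)) (PVar 0)"]
    mtl_instance[OF _ assms assms(2), of "PImp (PAnd (PVar 0) (PVar 1)) (PAnd (PVar 1) (PVar 0))"]
    mtl_instance[OF _ assms assms(2), of "PImp (PFus (PVar 0) (PImp (PVar 0) (PVar 1))) (PAnd (PVar 0) (PVar 1))"]
    mtl_instance[OF _ assms assms(2), of "PIff (POr (PVar 0) (PVar 1))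
      (PAnd (PImp (PImp (PVar 0) (PVar 1)) (PVar 1)) (PImp (PImp (PVar 1) (PVar 0)) (PVar 0)))"]
  by (simp_all add: mtl_axioms_def Let_def PIff_def)

lemma ex_falso: "pwf L \<phi> \<Longrightarrow> pderiv L T (PImp PBot \<phi>)"
  using mtl_instance[of "PImp PBot (PVar 0)" \<phi> \<phi> \<phi>] by (simp add: mtl_axioms_def Let_def)

lemma top_iff: "pderiv L T (PIff PTop (PImp PBot PBot))"
  using mtl_axiom[of "PIff PTop (PImp PBot PBot)" PVar] by (simp add: mtl_axioms_def Let_def PIff_def)

text \<open>Modus ponens need not be among the rules of \<open>L\<close>. It is imported from MTL as
  a derivation from two schematic hypotheses, which are then replaced by the given
  derivations.\<close>

lemma mp:
  assumes "pderiv L T \<phi>" and "pderiv L T (PImp \<phi> \<psi>)"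
  shows "pderiv L T \<psi>"
proof -
  let ?H = "[PVar 0, PImp (PVar 0) (PVar 1)]"
  have "pderiv MTL (set ?H) (psubst PVar (PVar 1))"
    by (rule pderiv.rl[of ?H]) (auto simp: MTL_def intro: pderiv.hyp)
  then have "pderiv L (set ?H) (PVar 1)"
    by (auto intro: MTL_pderiv)
  moreover have "pwf L (assign3 \<phi> \<psi> \<psi> p)" for p
    using assms by (auto simp: assign3_def dest: pderiv_pwf)
  ultimately have "pderiv L T (psubst (assign3 \<phi> \<psi> \<psi>) (PVar 1))"
    by (rule pderiv_cut) (use assms in auto)
  then show ?thesis by simp
qed

lemma imp_trans:
  assumes "pderiv L T (PImp \<phi> \<psi>)" and "pderiv L T (PImp \<psi> \<chi>)"
  shows "pderiv L T (PImp \<phi> \<chi>)"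
  by (rule mp[OF assms(2) mp[OF assms(1) suffixing]]) (use assms[THEN pderiv_pwf] in auto)

lemma fusD1: "pderiv L T (PFus \<phi> \<psi>) \<Longrightarrow> pderiv L T \<phi>"
  using pderiv_pwf[of T "PFus \<phi> \<psi>"] mp[OF _ fus_left] by simp

lemma fusD2: "pderiv L T (PFus \<phi> \<psi>) \<Longrightarrow> pderiv L T \<psi>"
  using pderiv_pwf[of T "PFus \<phi> \<psi>"] fusD1[OF mp[OF _ fus_comm]] by simp

lemma andD1: "pderiv L T (PAnd \<phi> \<psi>) \<Longrightarrow> pderiv L T \<phi>"
  using pderiv_pwf[of T "PAnd \<phi> \<psi>"] mp[OF _ and_left] by simp

lemma andD2: "pderiv L T (PAnd \<phi> \<psi>) \<Longrightarrow> pderiv L T \<psi>"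
  using pderiv_pwf[of T "PAnd \<phi> \<psi>"] andD1[OF mp[OF _ and_comm]] by simp

text \<open>Exporting the axiom that a fusion implies its left factor yields
  \<open>PImp \<psi> (PImp \<phi> \<psi>)\<close>.\<close>

lemma weakening: "pwf L \<phi> \<Longrightarrow> pderiv L T \<psi> \<Longrightarrow> pderiv L T (PImp \<phi> \<psi>)"
  using pderiv_pwf[of T \<psi>] mp[OF _ mp[OF fus_left exportation]] by simp

text \<open>Reflexivity is not an axiom. The formula 0 -> 0, an instance of ex falso, serves as a
  derivable left factor: its fusion with \<open>\<phi>\<close> implies \<open>\<phi>\<close>, and
  exporting then detaching it leaves the claim.\<close>

lemma imp_refl:
  assumes "pwf L \<phi>"
  shows "pderiv L T (PImp \<phi> \<phi>)"
proof -
  let ?\<theta> = "PImp PBot PBot"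
  have "pderiv L T (PImp (PFus ?\<theta> \<phi>) \<phi>)"
    by (rule imp_trans[OF fus_comm fus_left]) (use assms in auto)
  then have "pderiv L T (PImp ?\<theta> (PImp \<phi> \<phi>))"
    by (rule mp[OF _ exportation]) (use assms in auto)
  then show ?thesis by (rule mp[OF ex_falso[of PBot, simplified]])
qed

lemma fusI:
  assumes "pderiv L T \<phi>" and "pderiv L T \<psi>"
  shows "pderiv L T (PFus \<phi> \<psi>)"
proof -
  have "pderiv L T (PImp \<phi> (PImp \<psi> (PFus \<phi> \<psi>)))"
    by (rule mp[OF imp_refl exportation]) (use assms[THEN pderiv_pwf] in auto)
  then show ?thesis using assms(2) mp[OF assms(1)] by (blast intro: mp[OF assms(2)])
qed

text \<open>Divisibility produces the lattice conjunction from \<open>\<phi>\<close> fused with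
  \<open>PImp \<phi> \<psi>\<close>, and the latter follows from \<open>\<psi>\<close> by
  weakening.\<close>

lemma andI:
  assumes "pderiv L T \<phi>" and "pderiv L T \<psi>"
  shows "pderiv L T (PAnd \<phi> \<psi>)"
  by (rule mp[OF fusI divisibility]) (use assms assms[THEN pderiv_pwf] in \<open>auto intro: weakening\<close>)

lemma iffD:
  assumes "pderiv L T (PIff \<phi> \<psi>)"
  shows "pderiv L T \<phi> \<longleftrightarrow> pderiv L T \<psi>"
  using assms unfolding PIff_def by (metis mp fusD1 fusD2)

lemma pderiv_top: "pderiv L T PTop"
  using iffD[OF top_iff] ex_falso[of PBot] by simp

lemma assertion:
  assumes "pwf L \<phi>" "pwf L \<psi>"
  shows "pderiv L T (PImp \<phi> (PImp (PImp \<phi> \<psi>) \<psi>))"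
proof -
  have "pderiv L T (PImp (PFus \<phi> (PImp \<phi> \<psi>)) \<psi>)"
    by (rule imp_trans[OF divisibility imp_trans[OF and_comm and_left]]) (use assms in auto)
  then show ?thesis
    by (rule mp[OF _ exportation]) (use assms in auto)
qed

text \<open>Disjunction is reached through its defining equivalence. Of the two implications there,
  one is an instance of \<open>assertion\<close> and the other has the derivable formula as its
  consequent.\<close>

lemma orI1:
  assumes "pderiv L T \<phi>" "pwf L \<psi>"
  shows "pderiv L T (POr \<phi> \<psi>)"
proof -
  have "pwf L \<phi>" using assms(1) by (rule pderiv_pwf)
  then show ?thesis
    using assms andI[OF mp[OF assms(1) assertion] weakening[OF _ assms(1)]]
    by (subst iffD[OF or_iff]) simp_all
qed

lemma orI2:
  assumes "pderiv L T \<psi>" "pwf L \<phi>"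
  shows "pderiv L T (POr \<phi> \<psi>)"
proof -
  have "pwf L \<psi>" using assms(1) by (rule pderiv_pwf)
  then show ?thesis
    using assms andI[OF weakening[OF _ assms(1)] mp[OF assms(1) assertion]]
    by (subst iffD[OF or_iff]) simp_all
qed

end


section \<open>The two-valued algebra\<close>

definition truth_const :: "bool \<Rightarrow> 'c pform" where
  "truth_const b = (if b then PTop else PBot)"

lemma pwf_truth_const [simp]: "pwf L (truth_const b)"
  and pvars_truth_const [simp]: "pvars (truth_const b) = {}"
  by (auto simp: truth_const_def)

lemma oper_two: "oper (two L) c bs = pderiv L {} (PConn c (map truth_const bs))"
  by (simp add: two_def truth_const_def[abs_def])

lemma two_simps [simp]:
  "carrier (two L) = UNIV" "meet (two L) = (\<and>)" "join (two L) = (\<or>)" "mult (two L) = (\<and>)"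
  "resid (two L) = (\<longrightarrow>)" "zero (two L) = False" "one (two L) = True"
  by (simp_all add: two_def)

text \<open>The second assumption keeps 0 and 1 apart: if 0 were derivable, every formula would be,
  and derivability could not define a truth value.\<close>

locale two_constants_logic = core_logic +
  assumes only_constants: "only_constants_0_1 L"
    and not_bot: "\<not> pderiv L {} PBot"
begin

text \<open>Derivability decides which constant it is: a derivable formula equivalent to 0 would
  make 0 derivable, and a formula equivalent to 1 is itself derivable.\<close>

lemma closed_iff_truth_const:
  assumes "pwf L \<phi>" and "pvars \<phi> = {}"
  shows "pderiv L {} (PIff \<phi> (truth_const (pderiv L {} \<phi>)))"
proof -
  have "pderiv L {} (PIff \<phi> PBot) \<or> pderiv L {} (PIff \<phi> PTop)"
    using only_constants assms unfolding only_constants_0_1_def by blast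
  then show ?thesis
    using iffD[of "{}" \<phi>] not_bot pderiv_top by (auto simp: truth_const_def)
qed

text \<open>Congruence exchanges the formula put for a single variable, so the arguments are
  replaced from left to right, with \<open>\<chi>s\<close> collecting those already treated. All
  arguments being closed, \<open>PVar 0\<close> occurs only in the slot under exchange.\<close>

lemma conn_cong:
  assumes "list_all2 (\<lambda>\<phi> \<psi>. pderiv L {} (PIff \<phi> \<psi>) \<and> pvars \<phi> = {} \<and> pvars \<psi> = {}) \<phi>s \<psi>s"
    and "\<forall>\<phi>\<in>set \<phi>s. pwf L \<phi> \<and> pvars \<phi> = {}"
    and "\<forall>\<chi>\<in>set \<chi>s. pwf L \<chi> \<and> pvars \<chi> = {}"
    and "c \<in> conns L" and "length (\<chi>s @ \<phi>s) = carity L c"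
  shows "pderiv L {} (PConn c (\<chi>s @ \<phi>s)) \<longleftrightarrow> pderiv L {} (PConn c (\<chi>s @ \<psi>s))"
  using assms
proof (induction arbitrary: \<chi>s rule: list_all2_induct)
  case Nil
  then show ?case by simp
next
  case (Cons \<phi> \<phi>s \<psi> \<psi>s)
  have wf: "pwf L \<phi>" "pwf L \<psi>"
    using pderiv_pwf[of "{}" "PIff \<phi> \<psi>"] Cons.hyps(1) by (simp_all add: PIff_def)
  let ?\<chi> = "PConn c (\<chi>s @ PVar 0 # \<phi>s)"
  have sub: "psubst (PVar(0 := \<theta>)) ?\<chi> = PConn c (\<chi>s @ \<theta> # \<phi>s)" for \<theta>
    using Cons.prems by (auto intro!: map_idI psubst_closed)
  have "pwf L ?\<chi>"
    using Cons.prems by auto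
  from congruence[OF wf this, of 0]
  have *: "pderiv L {PIff \<phi> \<psi>} (PIff (PConn c (\<chi>s @ \<phi> # \<phi>s)) (PConn c (\<chi>s @ \<psi> # \<phi>s)))"
    unfolding sub .
  \<comment> \<open>A cut removes the hypothesis \<open>PIff \<phi> \<psi>\<close>, which is
    derivable outright.\<close>
  have "pderiv L {} (psubst PVar (PIff (PConn c (\<chi>s @ \<phi> # \<phi>s)) (PConn c (\<chi>s @ \<psi> # \<phi>s))))"
    by (rule pderiv_cut[OF *]) (use Cons.hyps(1) in simp_all)
  then have "pderiv L {} (PConn c (\<chi>s @ \<phi> # \<phi>s)) \<longleftrightarrow> pderiv L {} (PConn c (\<chi>s @ \<psi> # \<phi>s))"
    by (simp add: iffD)
  also have "\<dots> \<longleftrightarrow> pderiv L {} (PConn c (\<chi>s @ \<psi> # \<psi>s))"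
    using Cons.IH[of "\<chi>s @ [\<psi>]"] Cons.prems Cons.hyps(1) wf by simp
  finally show ?case .
qed

text \<open>An underivable closed antecedent is equivalent to 0, hence implies everything; a
  derivable one is handled by modus ponens and weakening.\<close>

lemma pderiv_imp_iff:
  assumes "pwf L \<phi>" "pvars \<phi> = {}" "pwf L \<psi>"
  shows "pderiv L {} (PImp \<phi> \<psi>) \<longleftrightarrow> (pderiv L {} \<phi> \<longrightarrow> pderiv L {} \<psi>)"
proof (cases "pderiv L {} \<phi>")
  case True
  then show ?thesis using assms mp[OF True] by (auto intro: weakening)
next
  case False
  then have "pderiv L {} (PImp \<phi> PBot)"
    using closed_iff_truth_const[of \<phi>] assms by (auto simp: truth_const_def PIff_def dest: fusD1)
  then have "pderiv L {} (PImp \<phi> \<psi>)"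
    using ex_falso[OF assms(3)] by (rule imp_trans)
  then show ?thesis using False by simp
qed

text \<open>The disjunction yields \<open>PImp (PImp \<phi> \<psi>) \<psi>\<close>. If
  \<open>\<phi>\<close> is underivable, then \<open>PImp \<phi> \<psi>\<close> is derivable because
  \<open>\<phi>\<close> is closed, and \<open>\<psi>\<close> follows.\<close>

lemma pderiv_or_iff:
  assumes "pwf L \<phi>" "pvars \<phi> = {}" "pwf L \<psi>"
  shows "pderiv L {} (POr \<phi> \<psi>) \<longleftrightarrow> (pderiv L {} \<phi> \<or> pderiv L {} \<psi>)"
proof
  assume "pderiv L {} (POr \<phi> \<psi>)"
  then have "pderiv L {} (PImp (PImp \<phi> \<psi>) \<psi>)"
    using assms iffD[OF or_iff] by (blast dest: andD1)
  then show "pderiv L {} \<phi> \<or> pderiv L {} \<psi>"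
    using assms pderiv_imp_iff[of \<phi> \<psi>] mp[of _ "PImp \<phi> \<psi>" \<psi>] by blast
qed (use assms in \<open>auto intro: orI1 orI2\<close>)

text \<open>This is the truth lemma that turns semantics into syntax. For an extra connective,
  \<open>oper\<close> applies it to the constants naming the argument values, while the substituted
  formula contains the arguments themselves; \<open>conn_cong\<close> bridges the two.\<close>

lemma pval_two:
  assumes "pwf L \<phi>"
  shows "pval (two L) e \<phi> \<longleftrightarrow> pderiv L {} (psubst (\<lambda>p. truth_const (e p)) \<phi>)"
  using assms
proof (induction \<phi>)
  case (PVar p)
  then show ?case using not_bot pderiv_top by (simp add: truth_const_def)
next
  case (PConn c \<phi>s)
  let ?s = "psubst (\<lambda>p. truth_const (e p))"
  have "pval (two L) e (PConn c \<phi>s)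
      \<longleftrightarrow> pderiv L {} (PConn c (map (\<lambda>\<phi>. truth_const (pderiv L {} (?s \<phi>))) \<phi>s))"
    using PConn by (simp add: oper_two o_def cong: map_cong)
  also have "\<dots> \<longleftrightarrow> pderiv L {} (PConn c (map ?s \<phi>s))"
    using PConn.prems conn_cong[of "map ?s \<phi>s" "map (\<lambda>\<phi>. truth_const (pderiv L {} (?s \<phi>))) \<phi>s" "[]" c]
    by (auto simp: list_all2_conv_all_nth pvars_psubst pwf_psubst closed_iff_truth_const)
  finally show ?case by simp
qed (use not_bot pderiv_top in \<open>auto simp: pderiv_imp_iff pderiv_or_iff pwf_psubst pvars_psubst
      intro: fusI andI dest: fusD1 fusD2 andD1 andD2\<close>)

text \<open>Truth under \<open>e\<close> is derivability of one closed instance. Instances of axioms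
  are derivable, and a rule preserves truth since the rule itself applies to the closed instances of
  its premises.\<close>

lemma L_algebra_two: "L_algebra L (two L)"
proof -
  have "pval (two L) e \<phi>" if "pderiv L T \<phi>" and T: "\<forall>\<psi>\<in>T. pval (two L) e \<psi>" for T \<phi> e
    using that(1)
  proof induction
    case (hyp \<phi>)
    then show ?case using T by blast
  next
    case (ax \<alpha> \<sigma>)
    then show ?case
      using axiom_pwf[OF ax(1)] by (simp add: pval_two psubst_psubst pwf_psubst pderiv.ax)
  next
    case (rl \<Gamma> \<gamma> \<sigma>)
    have "pderiv L {} (psubst (\<lambda>p. truth_const (e p)) (psubst \<sigma> \<psi>))" if "\<psi> \<in> set \<Gamma>" for \<psi>
      using rl.IH[OF that] rl.hyps(2) rule_pwf[OF rl.hyps(1)] that by (simp add: pval_two pwf_psubst)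
    then show ?case
      using rl.hyps(1,2) rule_pwf[OF rl.hyps(1)]
      by (simp add: pval_two psubst_psubst pwf_psubst pderiv.rl[of \<Gamma>])
  qed
  then show ?thesis
    unfolding L_algebra_def MTL_algebra_def ale_def by auto
qed

end


section \<open>Residuation and the truth values of formulas\<close>

locale mtl_algebra =
  fixes A :: "('a, 'c) algebra"
  assumes mtl: "MTL_algebra A"
begin

lemma zero_carrier [simp]: "zero A \<in> carrier A"
  and one_carrier [simp]: "one A \<in> carrier A"
  and meet_carrier [simp]: "x \<in> carrier A \<Longrightarrow> y \<in> carrier A \<Longrightarrow> meet A x y \<in> carrier A"
  and join_carrier [simp]: "x \<in> carrier A \<Longrightarrow> y \<in> carrier A \<Longrightarrow> join A x y \<in> carrier A"
  and mult_carrier [simp]: "x \<in> carrier A \<Longrightarrow> y \<in> carrier A \<Longrightarrow> mult A x y \<in> carrier A"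
  and resid_carrier [simp]: "x \<in> carrier A \<Longrightarrow> y \<in> carrier A \<Longrightarrow> resid A x y \<in> carrier A"
  and residuation: "x \<in> carrier A \<Longrightarrow> y \<in> carrier A \<Longrightarrow> z \<in> carrier A \<Longrightarrow>
    ale A (mult A x y) z \<longleftrightarrow> ale A x (resid A y z)"
  and meet_commute: "x \<in> carrier A \<Longrightarrow> y \<in> carrier A \<Longrightarrow> meet A x y = meet A y x"
  and mult_commute: "x \<in> carrier A \<Longrightarrow> y \<in> carrier A \<Longrightarrow> mult A x y = mult A y x"
  and meet_join: "x \<in> carrier A \<Longrightarrow> y \<in> carrier A \<Longrightarrow> meet A x (join A x y) = x"
  and join_meet: "x \<in> carrier A \<Longrightarrow> y \<in> carrier A \<Longrightarrow> join A x (meet A x y) = x"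
  and zero_le: "x \<in> carrier A \<Longrightarrow> ale A (zero A) x"
  and le_one: "x \<in> carrier A \<Longrightarrow> ale A x (one A)"
  and one_mult: "x \<in> carrier A \<Longrightarrow> mult A (one A) x = x"
  using mtl unfolding MTL_algebra_def by (simp_all only: Ball_def) metis

lemma le_antisym: "x \<in> carrier A \<Longrightarrow> y \<in> carrier A \<Longrightarrow> ale A x y \<Longrightarrow> ale A y x \<Longrightarrow> x = y"
  using meet_commute[of x y] by (simp add: ale_def)

lemma le_refl: "x \<in> carrier A \<Longrightarrow> ale A x x"
  using meet_join[of x "meet A x x"] join_meet[of x x] by (simp add: ale_def)

lemma one_leD: "x \<in> carrier A \<Longrightarrow> ale A (one A) x \<Longrightarrow> x = one A"
  using le_antisym le_one by simp

lemma resid_eq_one_iff: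
  assumes "x \<in> carrier A" "y \<in> carrier A"
  shows "resid A x y = one A \<longleftrightarrow> ale A x y"
  using assms residuation[of "one A" x y] one_leD[of "resid A x y"] le_refl[of "one A"]
  by (auto simp: one_mult)

text \<open>Integrality puts a product below each of its factors, so a factor of 1 lies above
  1.\<close>

lemma mult_eq_oneD:
  assumes "x \<in> carrier A" "y \<in> carrier A" "mult A x y = one A"
  shows "x = one A"
proof -
  have "ale A (mult A y x) x"
    using assms residuation[of y x x] resid_eq_one_iff[of x x] le_refl le_one by simp
  then show ?thesis
    using assms by (simp add: mult_commute one_leD)
qed

text \<open>By residuation and commutativity, both sides say that the product of \<open>x\<close>
  and \<open>y\<close> is below \<open>z\<close>.\<close>

lemma le_resid_commute:
  assumes "x \<in> carrier A" "y \<in> carrier A" "z \<in> carrier A"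
  shows "ale A x (resid A y z) \<longleftrightarrow> ale A y (resid A x z)"
  using assms residuation[of x y z] residuation[of y x z] mult_commute[of x y] by simp

text \<open>Antisymmetry makes the infimum unique, so the definite description denotes it. The image
  under \<open>Some\<close> records that every value involved is defined.\<close>

lemma inf_value_eqI:
  assumes "is_inf A X m"
  shows "inf_value A (Some ` X) = Some m"
proof -
  have "(THE m. is_inf A X m) = m"
    using assms by (rule the_equality) (use assms in \<open>auto simp: is_inf_def intro: le_antisym\<close>)
  then show ?thesis
    using assms by (auto simp: inf_value_def Option.these_image_Some_eq)
qed

lemma sup_value_eqI:
  assumes "is_sup A X m"
  shows "sup_value A (Some ` X) = Some m"
proof -
  have "(THE m. is_sup A X m) = m"
    using assms by (rule the_equality) (use assms in \<open>auto simp: is_sup_def intro: le_antisym\<close>)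
  then show ?thesis
    using assms by (auto simp: sup_value_def Option.these_image_Some_eq)
qed

lemma inf_value_SomeD:
  assumes "inf_value A (Some ` X) = Some m"
  shows "is_inf A X m"
proof -
  obtain m' where "is_inf A X m'"
    using assms by (auto simp: inf_value_def Option.these_image_Some_eq split: if_splits)
  then show ?thesis using inf_value_eqI assms by fastforce
qed

lemma sup_value_SomeD:
  assumes "sup_value A (Some ` X) = Some m"
  shows "is_sup A X m"
proof -
  obtain m' where "is_sup A X m'"
    using assms by (auto simp: sup_value_def Option.these_image_Some_eq split: if_splits)
  then show ?thesis using sup_value_eqI assms by fastforce
qed

end

section \<open>Values of instances, coincidence and substitution\<close>

lemma those_map_Some: "(\<And>x. x \<in> set xs \<Longrightarrow> f x = Some (g x)) \<Longrightarrow> those (map f xs) = Some (map g xs)"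
  by (induction xs) auto

lemma those_map_eq_NoneD: "those (map f xs) = None \<Longrightarrow> \<exists>x\<in>set xs. f x = None"
  by (induction xs) (auto split: option.splits)

lemma lift2_Some [simp]: "lift2 f (Some a) (Some b) = Some (f a b)"
  by (simp add: lift2_def)

lemma fval_instance_of:
  "(\<And>p. fval A M v (\<sigma> p) = Some (e p)) \<Longrightarrow> fval A M v (instance_of \<sigma> \<alpha>) = Some (pval A e \<alpha>)"
proof (induction \<alpha>)
  case (PConn c \<alpha>s)
  have "those (map (\<lambda>\<alpha>. fval A M v (instance_of \<sigma> \<alpha>)) \<alpha>s) = Some (map (pval A e) \<alpha>s)"
    using PConn by (intro those_map_Some) auto
  then show ?case by (simp add: o_def)
qed auto

lemma tval_cong: "(\<And>x. x \<in> tvars t \<Longrightarrow> v x = w x) \<Longrightarrow> tval M v t = tval M w t"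
proof (induction t)
  case (Fn F ts)
  then have "map (tval M v) ts = map (tval M w) ts" by auto
  then show ?case by (simp only: tval.simps)
qed simp

lemma fval_cong: "(\<And>x. x \<in> fv \<phi> \<Longrightarrow> v x = w x) \<Longrightarrow> fval A M v \<phi> = fval A M w \<phi>"
proof (induction \<phi> arbitrary: v w)
  case (Pred P ts)
  then have "map (tval M v) ts = map (tval M w) ts"
    by (auto intro!: tval_cong)
  then show ?case by (simp only: fval.simps)
next
  case (Conn c \<phi>s)
  have "fval A M v \<phi> = fval A M w \<phi>" if "\<phi> \<in> set \<phi>s" for \<phi>
    by (rule Conn.IH[OF that]) (use that Conn.prems in auto)
  then have "map (fval A M v) \<phi>s = map (fval A M w) \<phi>s" by simp
  then show ?case by (simp only: fval.simps)
next
  case (Forall x \<phi>)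
  then have "fval A M (v(x := d)) \<phi> = fval A M (w(x := d)) \<phi>" for d
    by (intro Forall.IH) auto
  then show ?case by simp
next
  case (Exists x \<phi>)
  then have "fval A M (v(x := d)) \<phi> = fval A M (w(x := d)) \<phi>" for d
    by (intro Exists.IH) auto
  then show ?case by simp
next
  case (And \<phi> \<psi>)
  show ?case using And.prems And.IH(1)[of v w] And.IH(2)[of v w] by simp
next
  case (Or \<phi> \<psi>)
  show ?case using Or.prems Or.IH(1)[of v w] Or.IH(2)[of v w] by simp
next
  case (Fus \<phi> \<psi>)
  show ?case using Fus.prems Fus.IH(1)[of v w] Fus.IH(2)[of v w] by simp
next
  case (Imp \<phi> \<psi>)
  show ?case using Imp.prems Imp.IH(1)[of v w] Imp.IH(2)[of v w] by simp
qed simp_all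

lemma fval_upd_not_free: "x \<notin> fv \<phi> \<Longrightarrow> fval A M (v(x := d)) \<phi> = fval A M v \<phi>"
  by (rule fval_cong) auto

lemma tsubst_not_free: "x \<notin> tvars u \<Longrightarrow> tsubst x t u = u"
  by (induction u) (auto intro: map_idI)

lemma fsubst_not_free: "x \<notin> fv \<phi> \<Longrightarrow> fsubst x t \<phi> = \<phi>"
  by (induction \<phi>) (auto intro!: map_idI tsubst_not_free)

lemma tval_tsubst: "tval M v (tsubst x t u) = tval M (v(x := tval M v t)) u"
  by (induction u) (auto simp: o_def cong: map_cong)

text \<open>Under a quantifier over \<open>y\<close> there are two cases. If \<open>x\<close> is
  free in the quantified formula, substitutability keeps \<open>y\<close> out of \<open>t\<close>,
  so updating \<open>y\<close> leaves the value of \<open>t\<close> alone. Otherwise, including the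
  case where \<open>y\<close> is \<open>x\<close>, neither the substitution nor the value given to
  \<open>x\<close> has any effect.\<close>

lemma fval_fsubst:
  "substitutable x t \<phi> \<Longrightarrow> fval A M v (fsubst x t \<phi>) = fval A M (v(x := tval M v t)) \<phi>"
proof (induction \<phi> arbitrary: v)
  case (Pred P ts)
  have "map (tval M v) (map (tsubst x t) ts) = map (tval M (v(x := tval M v t))) ts"
    by (simp add: tval_tsubst del: fun_upd_apply)
  then show ?case by (simp only: fval.simps fsubst.simps)
next
  case (Conn c \<phi>s)
  then have "map (fval A M v) (map (fsubst x t) \<phi>s) = map (fval A M (v(x := tval M v t))) \<phi>s"
    by (auto simp del: fun_upd_apply)
  then show ?case by (simp only: fval.simps fsubst.simps)
next
  case (Forall y \<phi>)
  have "fval A M (v(y := d)) (if y = x then \<phi> else fsubst x t \<phi>)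
      = fval A M (v(x := tval M v t, y := d)) \<phi>" for d
  proof (cases "x \<in> fv (Forall y \<phi>)")
    case True
    then have "tval M (v(y := d)) t = tval M v t"
      using Forall.prems by (intro tval_cong) auto
    then show ?thesis
      using True Forall.prems Forall.IH[of "v(y := d)"] fun_upd_twist[of y x v d "tval M v t"]
      by (auto simp del: fun_upd_apply)
  next
    case False
    then show ?thesis by (auto simp: fsubst_not_free intro!: fval_cong)
  qed
  then show ?case by (simp only: fval.simps fsubst.simps)
next
  case (Exists y \<phi>)
  have "fval A M (v(y := d)) (if y = x then \<phi> else fsubst x t \<phi>)
      = fval A M (v(x := tval M v t, y := d)) \<phi>" for d
  proof (cases "x \<in> fv (Exists y \<phi>)")
    case True
    then have "tval M (v(y := d)) t = tval M v t"
      using Exists.prems by (intro tval_cong) auto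
    then show ?thesis
      using True Exists.prems Exists.IH[of "v(y := d)"] fun_upd_twist[of y x v d "tval M v t"]
      by (auto simp del: fun_upd_apply)
  next
    case False
    then show ?thesis by (auto simp: fsubst_not_free intro!: fval_cong)
  qed
  then show ?case by (simp only: fval.simps fsubst.simps)
qed simp_all


section \<open>Soundness\<close>

lemma twf_tsubst: "twf \<Sigma> u \<Longrightarrow> twf \<Sigma> t \<Longrightarrow> twf \<Sigma> (tsubst x t u)"
  by (induction u) auto

lemma fwf_fsubst: "fwf L \<Sigma> \<phi> \<Longrightarrow> twf \<Sigma> t \<Longrightarrow> fwf L \<Sigma> (fsubst x t \<phi>)"
  by (induction \<phi>) (auto intro: twf_tsubst)

lemma fwf_foldr_Forall [simp]: "fwf L \<Sigma> (foldr Forall xs \<phi>) = fwf L \<Sigma> \<phi>"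
  by (induction xs) auto

lemma fwf_big_fus: "(\<forall>\<phi>\<in>set \<phi>s. fwf L \<Sigma> \<phi>) \<Longrightarrow> fwf L \<Sigma> (big_fus \<phi>s)"
  by (induction \<phi>s rule: big_fus.induct) auto

lemma fwf_simeq: "similarity_language \<Sigma> \<Longrightarrow> fwf L \<Sigma> (simeq \<Sigma> s t) \<longleftrightarrow> twf \<Sigma> s \<and> twf \<Sigma> t"
  by (auto simp: simeq_def similarity_language_def)

lemma fwf_pairwise_sim: "similarity_language \<Sigma> \<Longrightarrow> fwf L \<Sigma> (pairwise_sim \<Sigma> xs ys)"
  unfolding pairwise_sim_def by (intro fwf_big_fus) (auto simp: fwf_simeq)

lemma fwf_sim_axioms:
  assumes "similarity_language \<Sigma>" "\<alpha> \<in> sim_axioms \<Sigma>"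
  shows "fwf L \<Sigma> \<alpha>"
  using assms(2) by cases (auto simp: assms(1) fwf_simeq fwf_pairwise_sim Iff_def)

context core_logic
begin

lemma prv_fwf:
  assumes "similarity_language \<Sigma>" and "prv L \<Sigma> \<Phi> \<phi>"
  shows "fwf L \<Sigma> \<phi>"
  using assms(2)
  by induction
    (auto intro: fwf_instance_of fwf_fsubst fwf_sim_axioms[OF assms(1)] dest: axiom_pwf rule_pwf)

end

locale L_structure = core_logic L for L :: "'c logic" +
  fixes \<Sigma> :: "('f, 'p) language" and A :: "('a, 'c) algebra" and M :: "('m, 'f, 'p, 'a) struct"
  assumes sim_lang: "similarity_language \<Sigma>" and struct: "is_structure L \<Sigma> A M"
begin

lemma L_alg: "L_algebra L A" and A_struct: "A_structure \<Sigma> A M" and safe: "safe L \<Sigma> A M"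
  and models_sim: "evaluation M v \<Longrightarrow> models A M v (sim_axioms \<Sigma>)"
  using struct unfolding is_structure_def by blast+

sublocale mtl_algebra A
  using L_alg by unfold_locales (simp add: L_algebra_def)

lemma pderiv_sound:
  "pderiv L T \<phi> \<Longrightarrow> (\<And>p. e p \<in> carrier A) \<Longrightarrow> (\<And>\<psi>. \<psi> \<in> T \<Longrightarrow> pval A e \<psi> = one A) \<Longrightarrow>
    pval A e \<phi> = one A"
  using L_alg unfolding L_algebra_def by blast

lemma tval_univ: "evaluation M v \<Longrightarrow> twf \<Sigma> t \<Longrightarrow> tval M v t \<in> univ M"
proof (induction t)
  case (Fn F ts)
  then have "set (map (tval M v) ts) \<subseteq> univ M" by auto
  then show ?case using Fn.prems A_struct unfolding A_structure_def by simp
qed (simp add: evaluation_def)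

lemma evaluation_upd: "evaluation M v \<Longrightarrow> d \<in> univ M \<Longrightarrow> evaluation M (v(x := d))"
  by (simp add: evaluation_def)

text \<open>Safety yields a value; the induction adds membership in the carrier, which the
  residuation laws presuppose. For a quantifier, the induction hypothesis makes all values over the
  domain defined, so the result is a genuine infimum or supremum.\<close>

lemma fval_carrier:
  "fwf L \<Sigma> \<phi> \<Longrightarrow> evaluation M v \<Longrightarrow> \<exists>a\<in>carrier A. fval A M v \<phi> = Some a"
proof (induction \<phi> arbitrary: v)
  case (Pred P ts)
  then have "set (map (tval M v) ts) \<subseteq> univ M" by (auto intro: tval_univ)
  then show ?case using Pred.prems A_struct unfolding A_structure_def by simp
next
  case (And \<phi> \<psi>)
  then obtain a b where "fval A M v \<phi> = Some a" "fval A M v \<psi> = Some b" "a \<in> carrier A" "b \<in> carrier A"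
    by (metis fwf.simps(4))
  then show ?case by simp
next
  case (Or \<phi> \<psi>)
  then obtain a b where "fval A M v \<phi> = Some a" "fval A M v \<psi> = Some b" "a \<in> carrier A" "b \<in> carrier A"
    by (metis fwf.simps(5))
  then show ?case by simp
next
  case (Fus \<phi> \<psi>)
  then obtain a b where "fval A M v \<phi> = Some a" "fval A M v \<psi> = Some b" "a \<in> carrier A" "b \<in> carrier A"
    by (metis fwf.simps(6))
  then show ?case by simp
next
  case (Imp \<phi> \<psi>)
  then obtain a b where "fval A M v \<phi> = Some a" "fval A M v \<psi> = Some b" "a \<in> carrier A" "b \<in> carrier A"
    by (metis fwf.simps(7))
  then show ?case by simp
next
  case (Conn c \<phi>s)
  then have "\<forall>\<phi>\<in>set \<phi>s. fval A M v \<phi> = Some (the (fval A M v \<phi>)) \<and> the (fval A M v \<phi>) \<in> carrier A"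
    by fastforce
  then have "those (map (fval A M v) \<phi>s) = Some (map (\<lambda>\<phi>. the (fval A M v \<phi>)) \<phi>s)"
    and "set (map (\<lambda>\<phi>. the (fval A M v \<phi>)) \<phi>s) \<subseteq> carrier A"
    by (auto intro!: those_map_Some)
  then show ?case
    using Conn.prems L_alg unfolding L_algebra_def by simp
next
  case (Forall x \<phi>)
  define h where "h d = the (fval A M (v(x := d)) \<phi>)" for d
  have "\<forall>d\<in>univ M. fval A M (v(x := d)) \<phi> = Some (h d)"
    using Forall.IH[OF _ evaluation_upd[OF Forall.prems(2)]] Forall.prems(1) unfolding h_def
    by (metis fwf.simps(9) option.sel)
  then have *: "(\<lambda>d. fval A M (v(x := d)) \<phi>) ` univ M = Some ` h ` univ M"
    by (auto simp: image_image)
  obtain m where m: "fval A M v (Forall x \<phi>) = Some m"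
    using safe Forall.prems unfolding safe_def by blast
  then have "is_inf A (h ` univ M) m"
    by (intro inf_value_SomeD) (simp add: *)
  then show ?case using m by (auto simp: is_inf_def)
next
  case (Exists x \<phi>)
  define h where "h d = the (fval A M (v(x := d)) \<phi>)" for d
  have "\<forall>d\<in>univ M. fval A M (v(x := d)) \<phi> = Some (h d)"
    using Exists.IH[OF _ evaluation_upd[OF Exists.prems(2)]] Exists.prems(1) unfolding h_def
    by (metis fwf.simps(10) option.sel)
  then have *: "(\<lambda>d. fval A M (v(x := d)) \<phi>) ` univ M = Some ` h ` univ M"
    by (auto simp: image_image)
  obtain m where m: "fval A M v (Exists x \<phi>) = Some m"
    using safe Exists.prems unfolding safe_def by blast
  then have "is_sup A (h ` univ M) m"
    by (intro sup_value_SomeD) (simp add: *)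
  then show ?case using m by (auto simp: is_sup_def)
qed simp_all

text \<open>Naming the values by a function \<open>h\<close> lets later arguments speak of bounds of
  a set of algebra elements instead of a set of options.\<close>

lemma fval_quantified:
  assumes "fwf L \<Sigma> \<phi>" "evaluation M v"
  obtains h where "\<And>d. d \<in> univ M \<Longrightarrow> fval A M (v(x := d)) \<phi> = Some (h d)"
    and "\<And>d. d \<in> univ M \<Longrightarrow> h d \<in> carrier A"
proof -
  have "\<forall>d\<in>univ M. \<exists>a. fval A M (v(x := d)) \<phi> = Some a \<and> a \<in> carrier A"
    using fval_carrier[OF assms(1) evaluation_upd[OF assms(2)]] by blast
  then show ?thesis using that by (metis (no_types))
qed

lemma fval_Forall:
  assumes "\<And>d. d \<in> univ M \<Longrightarrow> fval A M (v(x := d)) \<phi> = Some (h d)"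
    and "fwf L \<Sigma> \<phi>" "evaluation M v"
  obtains m where "fval A M v (Forall x \<phi>) = Some m" "is_inf A (h ` univ M) m"
proof -
  have *: "(\<lambda>d. fval A M (v(x := d)) \<phi>) ` univ M = Some ` h ` univ M"
    using assms(1) by (auto simp: image_image)
  obtain m where m: "fval A M v (Forall x \<phi>) = Some m"
    using fval_carrier[of "Forall x \<phi>" v] assms by auto
  moreover from m have "is_inf A (h ` univ M) m"
    by (intro inf_value_SomeD) (simp add: *)
  ultimately show ?thesis by (rule that)
qed

lemma fval_Exists:
  assumes "\<And>d. d \<in> univ M \<Longrightarrow> fval A M (v(x := d)) \<phi> = Some (h d)"
    and "fwf L \<Sigma> \<phi>" "evaluation M v"
  obtains m where "fval A M v (Exists x \<phi>) = Some m" "is_sup A (h ` univ M) m"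
proof -
  have *: "(\<lambda>d. fval A M (v(x := d)) \<phi>) ` univ M = Some ` h ` univ M"
    using assms(1) by (auto simp: image_image)
  obtain m where m: "fval A M v (Exists x \<phi>) = Some m"
    using fval_carrier[of "Exists x \<phi>" v] assms by auto
  moreover from m have "is_sup A (h ` univ M) m"
    by (intro sup_value_SomeD) (simp add: *)
  ultimately show ?thesis by (rule that)
qed

lemma fval_Imp_eq_one:
  assumes "fval A M v \<phi> = Some a" "fval A M v \<psi> = Some b" "a \<in> carrier A" "b \<in> carrier A" "ale A a b"
  shows "fval A M v (Imp \<phi> \<psi>) = Some (one A)"
  using assms by (simp add: resid_eq_one_iff)

text \<open>The evaluation stays arbitrary in the induction because generalization uses its premise
  under every update of \<open>v\<close>.\<close>

lemma prv_sound:
  assumes "prv L \<Sigma> \<Phi> \<phi>" and "evaluation M v" and "models A M v \<Phi>"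
  shows "fval A M v \<phi> = Some (one A)"
  using assms
proof (induction arbitrary: v)
  case (hyp \<phi> \<Phi>)
  then show ?case by (auto simp: models_def)
next
  case (ax \<alpha> \<sigma> \<Phi>)
  define e where "e p = the (fval A M v (\<sigma> p))" for p
  have "fval A M v (\<sigma> p) = Some (e p) \<and> e p \<in> carrier A" for p
    using fval_carrier[OF ax.hyps(2)[of p] ax.prems(1)] unfolding e_def by (metis option.sel)
  moreover have "pderiv L {} (psubst PVar \<alpha>)"
    using ax by (intro pderiv.ax) auto
  ultimately show ?case
    using pderiv_sound[of "{}" \<alpha> e] by (simp add: fval_instance_of)
next
  case (forall1 \<phi> t x \<Phi>)
  obtain h where h: "\<And>d. d \<in> univ M \<Longrightarrow> fval A M (v(x := d)) \<phi> = Some (h d)"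
    "\<And>d. d \<in> univ M \<Longrightarrow> h d \<in> carrier A"
    using fval_quantified[OF forall1.hyps(1) forall1.prems(1)] by metis
  obtain m where m: "fval A M v (Forall x \<phi>) = Some m" "is_inf A (h ` univ M) m"
    using fval_Forall[OF h(1) forall1.hyps(1) forall1.prems(1)] by metis
  have "tval M v t \<in> univ M"
    using forall1 by (intro tval_univ)
  then show ?case
    using forall1.hyps h m
    by (intro fval_Imp_eq_one[of _ _ m _ "h (tval M v t)"]) (auto simp: fval_fsubst is_inf_def)
next
  case (exists1 \<phi> t x \<Phi>)
  obtain h where h: "\<And>d. d \<in> univ M \<Longrightarrow> fval A M (v(x := d)) \<phi> = Some (h d)"
    "\<And>d. d \<in> univ M \<Longrightarrow> h d \<in> carrier A"
    using fval_quantified[OF exists1.hyps(1) exists1.prems(1)] by metis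
  obtain m where m: "fval A M v (Exists x \<phi>) = Some m" "is_sup A (h ` univ M) m"
    using fval_Exists[OF h(1) exists1.hyps(1) exists1.prems(1)] by metis
  have "tval M v t \<in> univ M"
    using exists1 by (intro tval_univ)
  then show ?case
    using exists1.hyps h m
    by (intro fval_Imp_eq_one[of _ _ "h (tval M v t)" _ m]) (auto simp: fval_fsubst is_sup_def)
next
  case (forall2 \<xi> \<phi> x \<Phi>)
  obtain h where h: "\<And>d. d \<in> univ M \<Longrightarrow> fval A M (v(x := d)) \<phi> = Some (h d)"
    "\<And>d. d \<in> univ M \<Longrightarrow> h d \<in> carrier A"
    using fval_quantified[OF forall2.hyps(2) forall2.prems(1)] by metis
  obtain m where m: "fval A M v (Forall x \<phi>) = Some m" "is_inf A (h ` univ M) m"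
    using fval_Forall[OF h(1) forall2.hyps(2) forall2.prems(1)] by metis
  obtain c where c: "fval A M v \<xi> = Some c" "c \<in> carrier A"
    using fval_carrier[OF forall2.hyps(1) forall2.prems(1)] by blast
  have "fval A M (v(x := d)) \<xi> = Some c" for d
    using c(1) forall2.hyps(3) by (simp add: fval_upd_not_free del: fun_upd_apply)
  then have "fval A M (v(x := d)) (Imp \<xi> \<phi>) = Some (resid A c (h d))" if "d \<in> univ M" for d
    using h that by simp
  then obtain k where k: "fval A M v (Forall x (Imp \<xi> \<phi>)) = Some k"
    "is_inf A ((\<lambda>d. resid A c (h d)) ` univ M) k"
    by (rule fval_Forall[of v x]) (use forall2 in auto)
  have kc: "k \<in> carrier A" and mc: "m \<in> carrier A"
    using k m by (auto simp: is_inf_def)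
  \<comment> \<open>Residuation moves \<open>c\<close> to the left, so the product becomes a lower
    bound of the values of \<open>\<phi>\<close> and lies below their infimum
    \<open>m\<close>.\<close>
  have "ale A (mult A k c) (h d)" if "d \<in> univ M" for d
    using that k(2) kc c h residuation by (auto simp: is_inf_def)
  then have "ale A (mult A k c) m"
    using m(2) kc c by (auto simp: is_inf_def)
  then have "ale A k (resid A c m)"
    using residuation kc c mc by simp
  then show ?case
    using k(1) m(1) c kc mc by (intro fval_Imp_eq_one[of _ _ k _ "resid A c m"]) auto
next
  case (exists2 \<xi> \<phi> x \<Phi>)
  obtain h where h: "\<And>d. d \<in> univ M \<Longrightarrow> fval A M (v(x := d)) \<phi> = Some (h d)"
    "\<And>d. d \<in> univ M \<Longrightarrow> h d \<in> carrier A"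
    using fval_quantified[OF exists2.hyps(2) exists2.prems(1)] by metis
  obtain s where s: "fval A M v (Exists x \<phi>) = Some s" "is_sup A (h ` univ M) s"
    using fval_Exists[OF h(1) exists2.hyps(2) exists2.prems(1)] by metis
  obtain c where c: "fval A M v \<xi> = Some c" "c \<in> carrier A"
    using fval_carrier[OF exists2.hyps(1) exists2.prems(1)] by blast
  have "fval A M (v(x := d)) \<xi> = Some c" for d
    using c(1) exists2.hyps(3) by (simp add: fval_upd_not_free del: fun_upd_apply)
  then have "fval A M (v(x := d)) (Imp \<phi> \<xi>) = Some (resid A (h d) c)" if "d \<in> univ M" for d
    using h that by simp
  then obtain k where k: "fval A M v (Forall x (Imp \<phi> \<xi>)) = Some k"
    "is_inf A ((\<lambda>d. resid A (h d) c) ` univ M) k"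
    by (rule fval_Forall[of v x]) (use exists2 in auto)
  have kc: "k \<in> carrier A" and sc: "s \<in> carrier A"
    using k s by (auto simp: is_inf_def is_sup_def)
  \<comment> \<open>Exchanging \<open>k\<close> and \<open>h d\<close> turns a family of bounds on
    \<open>k\<close> into one upper bound for all values of \<open>\<phi>\<close>, hence for their
    supremum \<open>s\<close>.\<close>
  have "ale A (h d) (resid A k c)" if "d \<in> univ M" for d
    using that k(2) kc c h le_resid_commute by (auto simp: is_inf_def)
  then have "ale A s (resid A k c)"
    using s(2) kc c by (auto simp: is_sup_def)
  then have "ale A k (resid A s c)"
    using le_resid_commute kc c sc by simp
  then show ?case
    using k(1) s(1) c kc sc by (intro fval_Imp_eq_one[of _ _ k _ "resid A s c"]) auto
next
  case (similarity \<alpha> \<Phi>)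
  then show ?case using models_sim by (auto simp: models_def)
next
  case (rl \<Gamma> \<gamma> \<sigma> \<Phi>)
  define e where "e p = the (fval A M v (\<sigma> p))" for p
  have e: "fval A M v (\<sigma> p) = Some (e p) \<and> e p \<in> carrier A" for p
    using fval_carrier[OF rl.hyps(2)[of p] rl.prems(1)] unfolding e_def by (metis option.sel)
  \<comment> \<open>The definition of an \<open>L\<close>-algebra speaks of derivations from
    hypotheses, so the rule is read as a one-step derivation of its conclusion from its
    premises.\<close>
  have "pderiv L (set \<Gamma>) (psubst PVar \<gamma>)"
    by (rule pderiv.rl[OF rl.hyps(1)]) (use rule_pwf[OF rl.hyps(1)] in \<open>auto intro: pderiv.hyp\<close>)
  moreover have "pval A e \<psi> = one A" if "\<psi> \<in> set \<Gamma>" for \<psi>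
    using rl.IH[OF that rl.prems] e by (simp add: fval_instance_of)
  ultimately show ?case
    using e pderiv_sound[of "set \<Gamma>" \<gamma> e] by (simp add: fval_instance_of)
next
  case (gen \<Psi> \<phi> \<Phi> x)
  have "fval A M (v(x := d)) \<phi> = Some (one A)" if "d \<in> univ M" for d
  proof (rule gen.IH)
    \<comment> \<open>The hypotheses \<open>\<Psi>\<close> used for the premise do not contain
      \<open>x\<close> free, so they keep the value 1 when \<open>x\<close> is reassigned.\<close>
    show "models A M (v(x := d)) \<Psi>"
      unfolding models_def
    proof
      fix \<psi> assume "\<psi> \<in> \<Psi>"
      then show "fval A M (v(x := d)) \<psi> = Some (one A)"
        using gen.hyps gen.prems(2) fval_upd_not_free[of x \<psi> A M v d] by (auto simp: models_def)
    qed
  qed (use that gen.prems evaluation_upd in blast)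
  then obtain m where "fval A M v (Forall x \<phi>) = Some m" "is_inf A ((\<lambda>d. one A) ` univ M) m"
    by (rule fval_Forall[of v x]) (use gen sim_lang prv_fwf in auto)
  then show ?case
    using one_leD[of m] le_refl[of "one A"] by (auto simp: is_inf_def)
qed

end


section \<open>Provable similarity of terms\<close>

text \<open>The matrices of the similarity axioms are quantifier-free, so only variables of the
  quantifier prefix can capture anything.\<close>

fun qfree :: "('f, 'p, 'c) fml \<Rightarrow> bool" where
  "qfree (And \<phi> \<psi>) = (qfree \<phi> \<and> qfree \<psi>)"
| "qfree (Or \<phi> \<psi>) = (qfree \<phi> \<and> qfree \<psi>)"
| "qfree (Fus \<phi> \<psi>) = (qfree \<phi> \<and> qfree \<psi>)"
| "qfree (Imp \<phi> \<psi>) = (qfree \<phi> \<and> qfree \<psi>)"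
| "qfree (Conn c \<phi>s) = (\<forall>\<phi>\<in>set \<phi>s. qfree \<phi>)"
| "qfree (Forall x \<phi>) = False"
| "qfree (Exists x \<phi>) = False"
| "qfree _ = True"

lemma qfree_substitutable: "qfree \<phi> \<Longrightarrow> substitutable x t \<phi>"
  by (induction \<phi>) auto

lemma qfree_fsubst: "qfree \<phi> \<Longrightarrow> qfree (fsubst x t \<phi>)"
  by (induction \<phi>) auto

lemma qfree_big_fus: "(\<forall>\<phi>\<in>set \<phi>s. qfree \<phi>) \<Longrightarrow> qfree (big_fus \<phi>s)"
  by (induction \<phi>s rule: big_fus.induct) auto

lemma qfree_simeq [simp]: "qfree (simeq \<Sigma> s t)"
  by (simp add: simeq_def)

lemma qfree_pairwise_sim: "qfree (pairwise_sim \<Sigma> xs ys)"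
  unfolding pairwise_sim_def by (intro qfree_big_fus) auto

section \<open>Instantiating a quantifier prefix\<close>

lemma substitutable_foldr_Forall:
  "set xs \<inter> tvars t = {} \<Longrightarrow> qfree \<phi> \<Longrightarrow> substitutable x t (foldr Forall xs \<phi>)"
  by (induction xs) (auto intro: qfree_substitutable)

lemma fsubst_foldr_Forall:
  "x \<notin> set xs \<Longrightarrow> fsubst x t (foldr Forall xs \<phi>) = foldr Forall xs (fsubst x t \<phi>)"
  by (induction xs) auto

text \<open>Single substitutions performed from the head of the list on, matching the removal of
  quantifiers from the outside in. In general this differs from simultaneous substitution.\<close>

definition tsubsts :: "(var \<times> 'f trm) list \<Rightarrow> 'f trm \<Rightarrow> 'f trm" where
  "tsubsts = fold (\<lambda>(x, t). tsubst x t)"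

definition fsubsts :: "(var \<times> 'f trm) list \<Rightarrow> ('f, 'p, 'c) fml \<Rightarrow> ('f, 'p, 'c) fml" where
  "fsubsts = fold (\<lambda>(x, t). fsubst x t)"

lemma substs_Nil [simp]: "tsubsts [] u = u" "fsubsts [] \<phi> = \<phi>"
  and substs_Cons [simp]: "tsubsts ((x, t) # \<sigma>) u = tsubsts \<sigma> (tsubst x t u)"
    "fsubsts ((x, t) # \<sigma>) \<phi> = fsubsts \<sigma> (fsubst x t \<phi>)"
  by (simp_all add: tsubsts_def fsubsts_def)

lemma tsubsts_Fn [simp]: "tsubsts \<sigma> (Fn F ts) = Fn F (map (tsubsts \<sigma>) ts)"
  by (induction \<sigma> arbitrary: ts) (auto intro: map_idI[symmetric])

lemma fsubsts_Pred [simp]: "fsubsts \<sigma> (Pred P ts) = Pred P (map (tsubsts \<sigma>) ts)"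
  by (induction \<sigma> arbitrary: ts) (auto intro: map_idI[symmetric])

lemma fsubsts_Top [simp]: "fsubsts \<sigma> Top = Top"
  by (induction \<sigma>) auto

lemma fsubsts_Fus [simp]: "fsubsts \<sigma> (Fus \<phi> \<psi>) = Fus (fsubsts \<sigma> \<phi>) (fsubsts \<sigma> \<psi>)"
  by (induction \<sigma> arbitrary: \<phi> \<psi>) auto

lemma fsubsts_Imp [simp]: "fsubsts \<sigma> (Imp \<phi> \<psi>) = Imp (fsubsts \<sigma> \<phi>) (fsubsts \<sigma> \<psi>)"
  by (induction \<sigma> arbitrary: \<phi> \<psi>) auto

lemma fsubsts_simeq [simp]: "fsubsts \<sigma> (simeq \<Sigma> s t) = simeq \<Sigma> (tsubsts \<sigma> s) (tsubsts \<sigma> t)"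
  by (simp add: simeq_def)

lemma fsubsts_big_fus: "fsubsts \<sigma> (big_fus \<phi>s) = big_fus (map (fsubsts \<sigma>) \<phi>s)"
  by (induction \<phi>s rule: big_fus.induct) auto

lemma fsubsts_pairwise_sim:
  "fsubsts \<sigma> (pairwise_sim \<Sigma> xs ys)
    = big_fus (map2 (simeq \<Sigma>) (map (tsubsts \<sigma>) (map Var xs)) (map (tsubsts \<sigma>) (map Var ys)))"
  by (simp add: pairwise_sim_def fsubsts_big_fus zip_map_map o_def split_def)

lemma tsubsts_not_free: "tvars t \<inter> fst ` set \<sigma> = {} \<Longrightarrow> tsubsts \<sigma> t = t"
  by (induction \<sigma>) (auto simp: tsubst_not_free)

text \<open>No inserted term contains a variable of the list, so later substitutions leave it alone;
  distinctness lets the earlier ones pass over \<open>x\<close>.\<close>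

lemma tsubsts_Var:
  "(x, t) \<in> set \<sigma> \<Longrightarrow> distinct (map fst \<sigma>) \<Longrightarrow> (\<And>y s. (y, s) \<in> set \<sigma> \<Longrightarrow> tvars s \<inter> fst ` set \<sigma> = {}) \<Longrightarrow>
    tsubsts \<sigma> (Var x) = t"
proof (induction \<sigma>)
  case (Cons p \<sigma>)
  obtain y s where p: "p = (y, s)" by force
  show ?case
  proof (cases "(x, t) = p")
    case True
    have "tvars s \<inter> fst ` set \<sigma> = {}"
      using Cons.prems(3)[of y s] p by auto
    then show ?thesis using True p by (simp add: tsubsts_not_free)
  next
    case False
    then have "(x, t) \<in> set \<sigma>" "x \<noteq> y"
      using Cons.prems(1,2) p by (auto simp: image_iff)
    moreover have "tvars s' \<inter> fst ` set \<sigma> = {}" if "(y', s') \<in> set \<sigma>" for y' s'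
      using Cons.prems(3)[of y' s'] that by auto
    ultimately show ?thesis using Cons.IH Cons.prems(2) p by simp
  qed
qed simp

lemma finite_tvars [simp]: "finite (tvars t)"
  by (induction t) auto

lemma ex_fresh_vars:
  assumes "finite (V :: var set)"
  shows "\<exists>zs. length zs = n \<and> distinct zs \<and> set zs \<inter> V = {}"
proof -
  obtain m where "\<forall>x\<in>V. x < m"
    using assms finite_nat_set_iff_bounded by blast
  then have "length [m..<m + n] = n \<and> distinct [m..<m + n] \<and> set [m..<m + n] \<inter> V = {}"
    by auto
  then show ?thesis by blast
qed

section \<open>Provable laws of similarity for arbitrary terms\<close>

context core_logic
begin

text \<open>The first-order calculus has only the rules of \<open>L\<close>, so modus ponens is
  imported from its propositional derivation.\<close>

lemma prv_mp:
  assumes "similarity_language \<Sigma>" "prv L \<Sigma> \<Phi> \<phi>" "prv L \<Sigma> \<Phi> (Imp \<phi> \<psi>)"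
  shows "prv L \<Sigma> \<Phi> \<psi>"
proof -
  let ?T = "{PVar 0, PImp (PVar 0) (PVar 1)}"
  have "pderiv L ?T (PVar 1)"
    by (rule mp[of _ "PVar 0"]) (auto intro: pderiv.hyp)
  moreover have "fwf L \<Sigma> (assign3 \<phi> \<psi> \<psi> p)" for p
    using assms(2,3)[THEN prv_fwf[OF assms(1)]] by (auto simp: assign3_def)
  ultimately have "prv L \<Sigma> \<Phi> (instance_of (assign3 \<phi> \<psi> \<psi>) (PVar 1))"
    by (rule pderiv_imp_prv) (use assms in auto)
  then show ?thesis by simp
qed

lemma prv_fus:
  assumes "similarity_language \<Sigma>" "prv L \<Sigma> \<Phi> \<phi>" "prv L \<Sigma> \<Phi> \<psi>"
  shows "prv L \<Sigma> \<Phi> (Fus \<phi> \<psi>)"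
proof -
  have "pderiv L {PVar 0, PVar 1} (PFus (PVar 0) (PVar 1))"
    by (rule fusI) (auto intro: pderiv.hyp)
  moreover have "fwf L \<Sigma> (assign3 \<phi> \<psi> \<psi> p)" for p
    using assms(2,3)[THEN prv_fwf[OF assms(1)]] by (auto simp: assign3_def)
  ultimately have "prv L \<Sigma> \<Phi> (instance_of (assign3 \<phi> \<psi> \<psi>) (PFus (PVar 0) (PVar 1)))"
    by (rule pderiv_imp_prv) (use assms in auto)
  then show ?thesis by simp
qed

lemma prv_Top: "prv L \<Sigma> \<Phi> Top"
  using pderiv_imp_prv[OF pderiv_top[of "{}"], of \<Sigma> "\<lambda>_. Bot"] by simp

lemma prv_big_fus:
  "similarity_language \<Sigma> \<Longrightarrow> (\<forall>\<phi>\<in>set \<phi>s. prv L \<Sigma> \<Phi> \<phi>) \<Longrightarrow> prv L \<Sigma> \<Phi> (big_fus \<phi>s)"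
  by (induction \<phi>s rule: big_fus.induct) (auto intro: prv_Top prv_fus)

text \<open>Each step removes the outermost quantifier. The term avoids the variables still bound,
  so it is substitutable, and distinctness lets the substitution pass through the remaining prefix
  down to the matrix, which stays quantifier-free.\<close>

lemma prv_fsubsts:
  assumes "similarity_language \<Sigma>" and "prv L \<Sigma> \<Phi> (foldr Forall (map fst \<sigma>) \<phi>)" and "qfree \<phi>"
    and "distinct (map fst \<sigma>)"
    and "\<And>x t. (x, t) \<in> set \<sigma> \<Longrightarrow> twf \<Sigma> t \<and> tvars t \<inter> fst ` set \<sigma> = {}"
  shows "prv L \<Sigma> \<Phi> (fsubsts \<sigma> \<phi>)"
  using assms(2-)
proof (induction \<sigma> arbitrary: \<phi>)
  case (Cons p \<sigma>)
  obtain x t where p: "p = (x, t)" by force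
  let ?\<psi> = "foldr Forall (map fst \<sigma>) \<phi>"
  have t: "twf \<Sigma> t" "tvars t \<inter> fst ` set \<sigma> = {}"
    using Cons.prems(4)[of x t] p by auto
  have "fwf L \<Sigma> ?\<psi>"
    using prv_fwf[OF assms(1) Cons.prems(1)] by simp
  moreover have "substitutable x t ?\<psi>"
    using t(2) Cons.prems(2) by (intro substitutable_foldr_Forall) auto
  ultimately have "prv L \<Sigma> \<Phi> (Imp (Forall x ?\<psi>) (fsubst x t ?\<psi>))"
    using t(1) by (intro prv.forall1)
  moreover have "prv L \<Sigma> \<Phi> (Forall x ?\<psi>)"
    using Cons.prems(1) p by simp
  ultimately have "prv L \<Sigma> \<Phi> (fsubst x t ?\<psi>)"
    using assms(1) by (blast intro: prv_mp)
  moreover have "x \<notin> set (map fst \<sigma>)"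
    using Cons.prems(3) p by simp
  ultimately have "prv L \<Sigma> \<Phi> (foldr Forall (map fst \<sigma>) (fsubst x t \<phi>))"
    by (simp add: fsubst_foldr_Forall)
  moreover have "twf \<Sigma> t' \<and> tvars t' \<inter> fst ` set \<sigma> = {}" if "(x', t') \<in> set \<sigma>" for x' t'
    using Cons.prems(4)[of x' t'] that by auto
  ultimately have "prv L \<Sigma> \<Phi> (fsubsts \<sigma> (fsubst x t \<phi>))"
    using Cons.prems by (intro Cons.IH qfree_fsubst) simp_all
  then show ?case using p by simp
qed simp

text \<open>The bound variables can be chosen away from the terms, so that substituting the terms one
  after the other amounts to substituting them simultaneously.\<close>

lemma sim_axiom_instance:
  assumes "similarity_language \<Sigma>"
    and ax: "\<And>zs. length zs = length us \<Longrightarrow> distinct zs \<Longrightarrow> foldr Forall zs (\<phi> zs) \<in> sim_axioms \<Sigma>"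
    and qf: "\<And>zs. qfree (\<phi> zs)"
    and us: "\<forall>u\<in>set us. twf \<Sigma> u"
  obtains zs \<sigma> where "length zs = length us" "map (tsubsts \<sigma>) (map Var zs) = us"
    "prv L \<Sigma> \<Phi> (fsubsts \<sigma> (\<phi> zs))"
proof -
  obtain zs where zs: "length zs = length us" "distinct zs" "set zs \<inter> (\<Union>u\<in>set us. tvars u) = {}"
    using ex_fresh_vars[of "\<Union>u\<in>set us. tvars u" "length us"] by auto
  let ?\<sigma> = "zip zs us"
  have fst: "map fst ?\<sigma> = zs" "fst ` set ?\<sigma> = set zs"
    using zs(1) by (simp_all flip: set_map)
  have wf: "twf \<Sigma> t \<and> tvars t \<inter> fst ` set ?\<sigma> = {}" if "(x, t) \<in> set ?\<sigma>" for x t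
    using that us zs(3) unfolding fst by (auto dest!: set_zip_rightD)
  have "tsubsts ?\<sigma> (Var (zs ! i)) = us ! i" if "i < length us" for i
    by (rule tsubsts_Var) (use that zs fst wf in \<open>auto simp: set_zip\<close>)
  then have "map (tsubsts ?\<sigma>) (map Var zs) = us"
    using zs(1) by (auto intro: nth_equalityI)
  moreover have "prv L \<Sigma> \<Phi> (foldr Forall (map fst ?\<sigma>) (\<phi> zs))"
    unfolding fst by (intro prv.similarity ax zs)
  then have "prv L \<Sigma> \<Phi> (fsubsts ?\<sigma> (\<phi> zs))"
    by (rule prv_fsubsts[OF assms(1)]) (use qf zs wf fst in auto)
  ultimately show ?thesis using that zs(1) by blast
qed

text \<open>The axiom is presented as a function of the list of its bound variables, the form in
  which \<open>sim_axiom_instance\<close> may choose them. The other similarity laws follow the same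
  pattern.\<close>

lemma prv_simeq_refl:
  fixes \<Sigma> :: "('f, 'p) language" and \<Phi> :: "('f, 'p, 'c) fml set"
  assumes "similarity_language \<Sigma>" "twf \<Sigma> t"
  shows "prv L \<Sigma> \<Phi> (simeq \<Sigma> t t)"
proof -
  let ?\<phi> = "\<lambda>zs. simeq \<Sigma> (Var (zs ! 0)) (Var (zs ! 0)) :: ('f, 'p, 'c) fml"
  have ax: "(foldr Forall zs (?\<phi> zs) :: ('f, 'p, 'c) fml) \<in> sim_axioms \<Sigma>"
    if "length zs = length [t]" for zs
    using that by (auto simp: length_Suc_conv intro: sim_axioms.refl)
  have qf: "qfree (?\<phi> zs)" for zs
    by (simp add: qfree_pairwise_sim)
  have wf: "\<forall>u\<in>set ([t]). twf \<Sigma> u"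
    using assms(2) by simp
  obtain zs \<sigma> where
    "length zs = length [t]" "map (tsubsts \<sigma>) (map Var zs) = [t]" "prv L \<Sigma> \<Phi> (fsubsts \<sigma> (?\<phi> zs))"
    by (rule sim_axiom_instance[where us = "[t]" and \<phi> = ?\<phi> and \<Phi> = \<Phi>, OF assms(1) ax qf wf])
  then show ?thesis by (cases zs) auto
qed

lemma prv_simeq_sym:
  fixes \<Sigma> :: "('f, 'p) language" and \<Phi> :: "('f, 'p, 'c) fml set"
  assumes "similarity_language \<Sigma>" "twf \<Sigma> s" "twf \<Sigma> t" "prv L \<Sigma> \<Phi> (simeq \<Sigma> s t)"
  shows "prv L \<Sigma> \<Phi> (simeq \<Sigma> t s)"
proof -
  let ?\<phi> = "\<lambda>zs. Imp (simeq \<Sigma> (Var (zs ! 0)) (Var (zs ! 1)))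
    (simeq \<Sigma> (Var (zs ! 1)) (Var (zs ! 0))) :: ('f, 'p, 'c) fml"
  have ax: "(foldr Forall zs (?\<phi> zs) :: ('f, 'p, 'c) fml) \<in> sim_axioms \<Sigma>"
    if "length zs = length [s, t]" "distinct zs" for zs
    using that sim_axioms.sym[of "zs ! 0" "zs ! 1" \<Sigma>] by (auto simp: length_Suc_conv)
  have qf: "qfree (?\<phi> zs)" for zs
    by (simp add: qfree_pairwise_sim)
  have wf: "\<forall>u\<in>set ([s, t]). twf \<Sigma> u"
    using assms(2,3) by simp
  obtain zs \<sigma> where
    "length zs = length [s, t]" "map (tsubsts \<sigma>) (map Var zs) = [s, t]" "prv L \<Sigma> \<Phi> (fsubsts \<sigma> (?\<phi> zs))"
    by (rule sim_axiom_instance[where us = "[s, t]" and \<phi> = ?\<phi> and \<Phi> = \<Phi>, OF assms(1) ax qf wf])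
  then have "prv L \<Sigma> \<Phi> (Imp (simeq \<Sigma> s t) (simeq \<Sigma> t s))"
    by (auto simp: length_Suc_conv)
  with assms(1,4) show ?thesis by (rule prv_mp)
qed

lemma prv_simeq_trans:
  fixes \<Sigma> :: "('f, 'p) language" and \<Phi> :: "('f, 'p, 'c) fml set"
  assumes "similarity_language \<Sigma>" "twf \<Sigma> s" "twf \<Sigma> t" "twf \<Sigma> u"
    and "prv L \<Sigma> \<Phi> (simeq \<Sigma> s t)" "prv L \<Sigma> \<Phi> (simeq \<Sigma> t u)"
  shows "prv L \<Sigma> \<Phi> (simeq \<Sigma> s u)"
proof -
  let ?\<phi> = "\<lambda>zs. Imp (Fus (simeq \<Sigma> (Var (zs ! 0)) (Var (zs ! 1))) (simeq \<Sigma> (Var (zs ! 1)) (Var (zs ! 2))))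
    (simeq \<Sigma> (Var (zs ! 0)) (Var (zs ! 2))) :: ('f, 'p, 'c) fml"
  have ax: "(foldr Forall zs (?\<phi> zs) :: ('f, 'p, 'c) fml) \<in> sim_axioms \<Sigma>"
    if "length zs = length [s, t, u]" "distinct zs" for zs
    using that sim_axioms.trans[of "zs ! 0" "zs ! 1" "zs ! 2" \<Sigma>] by (auto simp: length_Suc_conv)
  have qf: "qfree (?\<phi> zs)" for zs
    by (simp add: qfree_pairwise_sim)
  have wf: "\<forall>u\<in>set ([s, t, u]). twf \<Sigma> u"
    using assms(2-4) by simp
  obtain zs \<sigma> where
    "length zs = length [s, t, u]" "map (tsubsts \<sigma>) (map Var zs) = [s, t, u]"
    "prv L \<Sigma> \<Phi> (fsubsts \<sigma> (?\<phi> zs))"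
    by (rule sim_axiom_instance[where us = "[s, t, u]" and \<phi> = ?\<phi> and \<Phi> = \<Phi>, OF assms(1) ax qf wf])
  then have "prv L \<Sigma> \<Phi> (Imp (Fus (simeq \<Sigma> s t) (simeq \<Sigma> t u)) (simeq \<Sigma> s u))"
    by (auto simp: length_Suc_conv)
  moreover have "prv L \<Sigma> \<Phi> (Fus (simeq \<Sigma> s t) (simeq \<Sigma> t u))"
    using assms by (intro prv_fus)
  ultimately show ?thesis using assms(1) prv_mp by blast
qed

lemma prv_simeq_Fn:
  fixes \<Sigma> :: "('f, 'p) language" and \<Phi> :: "('f, 'p, 'c) fml set"
  assumes "similarity_language \<Sigma>" "F \<in> funs \<Sigma>" "length ss = farity \<Sigma> F" "length ts = farity \<Sigma> F"
    and "\<forall>t\<in>set (ss @ ts). twf \<Sigma> t"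
    and "\<forall>(s, t)\<in>set (zip ss ts). prv L \<Sigma> \<Phi> (simeq \<Sigma> s t)"
  shows "prv L \<Sigma> \<Phi> (simeq \<Sigma> (Fn F ss) (Fn F ts))"
proof -
  let ?n = "farity \<Sigma> F"
  \<comment> \<open>Both blocks of bound variables come from one list, since each variable must be
    fresh for \<open>ss\<close> and \<open>ts\<close> together; cutting at the arity separates them
    again.\<close>
  let ?\<phi> = "\<lambda>zs. Imp (pairwise_sim \<Sigma> (take ?n zs) (drop ?n zs))
    (simeq \<Sigma> (Fn F (map Var (take ?n zs))) (Fn F (map Var (drop ?n zs)))) :: ('f, 'p, 'c) fml"
  have ax: "(foldr Forall zs (?\<phi> zs) :: ('f, 'p, 'c) fml) \<in> sim_axioms \<Sigma>"
    if "length zs = length (ss @ ts)" "distinct zs" for zs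
    using sim_axioms.func[of F \<Sigma> "take ?n zs" "drop ?n zs"] that assms(2-4) by simp
  have qf: "qfree (?\<phi> zs)" for zs
    by (simp add: qfree_pairwise_sim)
  have wf: "\<forall>u\<in>set (ss @ ts). twf \<Sigma> u"
    using assms(5) by simp
  obtain zs \<sigma> where
    zs: "length zs = length (ss @ ts)" "map (tsubsts \<sigma>) (map Var zs) = ss @ ts"
    "prv L \<Sigma> \<Phi> (fsubsts \<sigma> (?\<phi> zs))"
    by (rule sim_axiom_instance[where us = "ss @ ts" and \<phi> = ?\<phi> and \<Phi> = \<Phi>, OF assms(1) ax qf wf])
  have "map (tsubsts \<sigma>) (map Var (take ?n zs)) = take ?n (ss @ ts)"
    and "map (tsubsts \<sigma>) (map Var (drop ?n zs)) = drop ?n (ss @ ts)"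
    by (simp_all only: zs(2)[symmetric] take_map drop_map)
  then have *: "map (tsubsts \<sigma>) (map Var (take ?n zs)) = ss"
    "map (tsubsts \<sigma>) (map Var (drop ?n zs)) = ts"
    using assms(3) by simp_all
  have "prv L \<Sigma> \<Phi> (Imp (big_fus (map2 (simeq \<Sigma>) ss ts)) (simeq \<Sigma> (Fn F ss) (Fn F ts)))"
    using zs(3) by (simp only: fsubsts_Imp fsubsts_pairwise_sim fsubsts_simeq tsubsts_Fn *)
  moreover have "prv L \<Sigma> \<Phi> (big_fus (map2 (simeq \<Sigma>) ss ts))"
    using assms(6) by (intro prv_big_fus[OF assms(1)]) auto
  ultimately show ?thesis using assms(1) prv_mp by blast
qed

end


section \<open>The term structure\<close>

locale term_model = core_logic L for L :: "'c logic" +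
  fixes \<Sigma> :: "('f, 'p) language" and \<Phi> :: "('f, 'p, 'c) fml set"
  assumes constants: "only_constants_0_1 L"
    and sim_lang: "similarity_language \<Sigma>"
    and consistent: "consistent L \<Sigma> \<Phi>"
begin

sublocale two_constants_logic L
proof unfold_locales
  show "\<not> pderiv L {} PBot"
  proof
    assume "pderiv L {} PBot"
    \<comment> \<open>The formula 0 has no variables, so the choice of substitution is
      immaterial.\<close>
    then have "prv L \<Sigma> \<Phi> (instance_of (\<lambda>_. Bot) PBot)"
      by (rule pderiv_imp_prv) auto
    then show False using consistent by (simp add: consistent_def)
  qed
qed (rule constants)

abbreviation "cls \<equiv> tclass L \<Sigma> \<Phi>"
abbreviation "TS \<equiv> term_structure L \<Sigma> \<Phi>"

lemma cls_eq_iff: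
  assumes "twf \<Sigma> s" "twf \<Sigma> t"
  shows "cls s = cls t \<longleftrightarrow> prv L \<Sigma> \<Phi> (simeq \<Sigma> s t)"
proof
  assume "cls s = cls t"
  moreover have "t \<in> cls t"
    using assms sim_lang by (simp add: tclass_def prv_simeq_refl)
  ultimately show "prv L \<Sigma> \<Phi> (simeq \<Sigma> s t)"
    by (auto simp: tclass_def)
next
  assume "prv L \<Sigma> \<Phi> (simeq \<Sigma> s t)"
  moreover from this have "prv L \<Sigma> \<Phi> (simeq \<Sigma> t s)"
    using assms sim_lang by (blast intro: prv_simeq_sym)
  ultimately show "cls s = cls t"
    using assms sim_lang unfolding tclass_def by (blast intro: prv_simeq_trans)
qed

lemma univ_TS: "univ TS = cls ` {t. twf \<Sigma> t}"
  by (simp add: term_structure_def)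

lemma cls_in_univ: "twf \<Sigma> t \<Longrightarrow> cls t \<in> univ TS"
  by (auto simp: univ_TS)

lemma ex_representatives:
  "set cs \<subseteq> univ TS \<Longrightarrow> \<exists>ts. (\<forall>t\<in>set ts. twf \<Sigma> t) \<and> cs = map cls ts"
proof (induction cs)
  case (Cons c cs)
  then obtain ts where "\<forall>t\<in>set ts. twf \<Sigma> t" "cs = map cls ts" by auto
  moreover obtain t where "twf \<Sigma> t" "c = cls t"
    using Cons.prems by (auto simp: univ_TS)
  ultimately show ?case by (intro exI[of _ "t # ts"]) simp
qed simp

text \<open>Lists with the same classes are provably similar entry by entry, and the congruence
  axiom for \<open>F\<close> then gives one class for all representatives, so the definite
  description denotes.\<close>

lemma fint_TS:
  assumes "F \<in> funs \<Sigma>" "length ts = farity \<Sigma> F" "\<forall>t\<in>set ts. twf \<Sigma> t"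
  shows "fint TS F (map cls ts) = cls (Fn F ts)"
proof -
  have "cls (Fn F ss) = cls (Fn F ts)" if "representatives L \<Sigma> \<Phi> (map cls ts) ss" for ss
  proof -
    have ss: "\<forall>s\<in>set ss. twf \<Sigma> s" "map cls ss = map cls ts"
      using that by (auto simp: representatives_def)
    then have len: "length ss = length ts" by (metis length_map)
    have "\<forall>(s, t)\<in>set (zip ss ts). prv L \<Sigma> \<Phi> (simeq \<Sigma> s t)"
    proof clarify
      fix s t assume "(s, t) \<in> set (zip ss ts)"
      then obtain i where i: "i < length ts" "s = ss ! i" "t = ts ! i"
        using len by (auto simp: set_zip)
      then have "cls s = cls t"
        using ss(2) len by (metis nth_map)
      moreover have "twf \<Sigma> s" "twf \<Sigma> t"
        using i ss(1) assms(3) len by auto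
      ultimately show "prv L \<Sigma> \<Phi> (simeq \<Sigma> s t)"
        by (simp add: cls_eq_iff)
    qed
    then have "prv L \<Sigma> \<Phi> (simeq \<Sigma> (Fn F ss) (Fn F ts))"
      using sim_lang assms ss(1) len by (intro prv_simeq_Fn) auto
    then show ?thesis
      using assms ss(1) len by (subst cls_eq_iff) auto
  qed
  moreover have "representatives L \<Sigma> \<Phi> (map cls ts) ts"
    using assms by (simp add: representatives_def)
  ultimately have "(THE c. \<exists>ss. representatives L \<Sigma> \<Phi> (map cls ts) ss \<and> c = cls (Fn F ss))
      = cls (Fn F ts)"
    by (intro the_equality) blast+
  then show ?thesis by (simp add: term_structure_def)
qed

lemma pint_TS:
  "pint TS P cs \<longleftrightarrow> (\<exists>ts. (\<forall>t\<in>set ts. twf \<Sigma> t) \<and> cs = map cls ts \<and> prv L \<Sigma> \<Phi> (Pred P ts))"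
  by (auto simp: term_structure_def representatives_def)

text \<open>Provable similarity is exactly equality of classes. Hence similarity is true equality in
  the term structure, which gives its reducedness and makes the similarity axioms laws of
  equality.\<close>

lemma pint_TS_sim:
  assumes "c \<in> univ TS" "d \<in> univ TS"
  shows "pint TS (sim \<Sigma>) [c, d] \<longleftrightarrow> c = d"
proof
  assume "pint TS (sim \<Sigma>) [c, d]"
  then obtain ts where ts: "\<forall>t\<in>set ts. twf \<Sigma> t" "[c, d] = map cls ts" "prv L \<Sigma> \<Phi> (Pred (sim \<Sigma>) ts)"
    unfolding pint_TS by (elim exE conjE) (rule that)
  then obtain s t where "ts = [s, t]" by (auto simp: Cons_eq_map_conv)
  then show "c = d"
    using ts cls_eq_iff[of s t] by (auto simp: simeq_def)
next
  assume "c = d"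
  moreover obtain t where "twf \<Sigma> t" "c = cls t"
    using assms by (auto simp: univ_TS)
  ultimately show "pint TS (sim \<Sigma>) [c, d]"
    using prv_simeq_refl[OF sim_lang, of t \<Phi>] by (auto simp: pint_TS simeq_def intro!: exI[of _ "[t, t]"])
qed

section \<open>The term structure as a reduced structure over the two-valued algebra\<close>

lemma A_structure_fint:
  "A_structure \<Sigma> A M \<Longrightarrow> F \<in> funs \<Sigma> \<Longrightarrow> length ds = farity \<Sigma> F \<Longrightarrow> set ds \<subseteq> univ M \<Longrightarrow>
    fint M F ds \<in> univ M"
  unfolding A_structure_def by blast

lemma A_structure_TS: "A_structure \<Sigma> (two L) TS"
  unfolding A_structure_def
proof (intro conjI ballI allI impI)
  show "univ TS \<noteq> {}"
    using cls_in_univ[of "Var 0"] by auto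
next
  fix F cs assume *: "F \<in> funs \<Sigma>" "length cs = farity \<Sigma> F" "set cs \<subseteq> univ TS"
  then obtain ts where "\<forall>t\<in>set ts. twf \<Sigma> t" "cs = map cls ts"
    using ex_representatives by blast
  then show "fint TS F cs \<in> univ TS"
    using * fint_TS[of F ts] by (auto intro: cls_in_univ)
qed simp

text \<open>The two-valued algebra is complete: the infimum and supremum of a set of truth values
  are universal and existential quantification over it. Hence every structure over it is
  safe.\<close>

lemma fval_two_defined: "fval (two L) N w \<phi> \<noteq> None"
proof (induction \<phi> arbitrary: w)
  case (Conn c \<phi>s)
  then have "those (map (fval (two L) N w) \<phi>s) \<noteq> None"
    using those_map_eq_NoneD[of "fval (two L) N w" \<phi>s] by blast
  then show ?case by simp
next
  case (Forall x \<phi>)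
  have "\<exists>m. is_inf (two L) X m" for X
    by (rule exI[of _ "\<forall>x\<in>X. x"]) (auto simp: is_inf_def ale_def)
  moreover have "None \<notin> (\<lambda>d. fval (two L) N (w(x := d)) \<phi>) ` univ N"
    by (simp add: image_iff Forall.IH[THEN not_sym])
  ultimately show ?case by (simp add: inf_value_def)
next
  case (Exists x \<phi>)
  have "\<exists>m. is_sup (two L) X m" for X
    by (rule exI[of _ "\<exists>x\<in>X. x"]) (auto simp: is_sup_def ale_def)
  moreover have "None \<notin> (\<lambda>d. fval (two L) N (w(x := d)) \<phi>) ` univ N"
    by (simp add: image_iff Exists.IH[THEN not_sym])
  ultimately show ?case by (simp add: sup_value_def)
qed (auto simp: lift2_def bind_eq_None_conv)

lemma MTL_algebra_two: "MTL_algebra (two L)"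
  using L_algebra_two by (simp add: L_algebra_def)

lemma fval_two_foldr_Forall:
  "(\<And>w. evaluation N w \<Longrightarrow> fval (two L) N w \<phi> = Some True) \<Longrightarrow> evaluation N w \<Longrightarrow>
    fval (two L) N w (foldr Forall xs \<phi>) = Some True"
proof (induction xs arbitrary: w)
  case (Cons x xs)
  interpret mtl_algebra "two L"
    by unfold_locales (rule MTL_algebra_two)
  have "(\<lambda>d. fval (two L) N (w(x := d)) (foldr Forall xs \<phi>)) ` univ N = Some ` (\<lambda>d. True) ` univ N"
    using Cons by (auto simp: image_image evaluation_def)
  moreover have "is_inf (two L) ((\<lambda>d. True) ` univ N) True"
    by (auto simp: is_inf_def ale_def)
  ultimately show ?case
    by (simp add: inf_value_eqI)
qed simp

lemma fval_two_big_fus: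
  "fval (two L) N w (big_fus \<phi>s) = Some (\<forall>\<phi>\<in>set \<phi>s. fval (two L) N w \<phi> = Some True)"
proof (induction \<phi>s rule: big_fus.induct)
  case (2 \<phi>)
  then show ?case using fval_two_defined[of N w \<phi>] by auto
next
  case (3 \<phi> \<psi> \<phi>s)
  then show ?case using fval_two_defined[of N w \<phi>] by auto
qed simp

lemma fval_simeq_TS:
  "evaluation TS w \<Longrightarrow> fval (two L) TS w (simeq \<Sigma> (Var x) (Var y)) = Some (w x = w y)"
  by (simp add: simeq_def pint_TS_sim evaluation_def)

text \<open>Equal lengths matter, because pairing the lists drops the surplus entries of the longer
  one.\<close>

lemma fval_pairwise_sim_TS:
  assumes "evaluation TS w" "length xs = length ys"
  shows "fval (two L) TS w (pairwise_sim \<Sigma> xs ys) = Some (map w xs = map w ys)"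
  using assms
  by (auto simp: pairwise_sim_def fval_two_big_fus fval_simeq_TS set_zip list_eq_iff_nth_eq)

lemma fval_Iff_refl: "fval (two L) N w \<phi> = fval (two L) N w \<psi> \<Longrightarrow> fval (two L) N w (Iff \<phi> \<psi>) = Some True"
  using fval_two_defined[of N w \<psi>] by (auto simp: Iff_def)

lemma models_sim_TS:
  assumes "evaluation TS w"
  shows "models (two L) TS w (sim_axioms \<Sigma>)"
  unfolding models_def
proof
  fix \<alpha> :: "('f, 'p, 'c) fml" assume "\<alpha> \<in> sim_axioms \<Sigma>"
  \<comment> \<open>Each axiom is a universal closure, so its matrix only has to be true under every
    evaluation.\<close>
  then obtain xs \<psi> where \<alpha>: "\<alpha> = foldr Forall xs \<psi>"
    and \<psi>: "\<And>w. evaluation TS w \<Longrightarrow> fval (two L) TS w \<psi> = Some True"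
  proof cases
    case (refl x)
    then show ?thesis
      by (intro that[of "[x]" "simeq \<Sigma> (Var x) (Var x)"]) (simp_all add: fval_simeq_TS)
  next
    case (sym x y)
    then show ?thesis
      by (intro that[of "[x, y]" "Imp (simeq \<Sigma> (Var x) (Var y)) (simeq \<Sigma> (Var y) (Var x))"])
        (simp_all add: fval_simeq_TS)
  next
    case (trans x y z)
    then show ?thesis
      by (intro that[of "[x, y, z]" "Imp (Fus (simeq \<Sigma> (Var x) (Var y)) (simeq \<Sigma> (Var y) (Var z)))
          (simeq \<Sigma> (Var x) (Var z))"])
        (simp_all add: fval_simeq_TS)
  next
    case (func F xs ys)
    show ?thesis
    proof (rule that[OF func(1)])
      fix w assume w: "evaluation TS w"
      \<comment> \<open>Similarity is known to be equality only on the universe, so the values of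
        \<open>F\<close> must be located there first.\<close>
      have "fint TS F (map w zs) \<in> univ TS" if "length zs = farity \<Sigma> F" for zs
        using w that by (intro A_structure_fint[OF A_structure_TS func(2)]) (auto simp: evaluation_def)
      then show "fval (two L) TS w (Imp (pairwise_sim \<Sigma> xs ys)
          (simeq \<Sigma> (Fn F (map Var xs)) (Fn F (map Var ys)))) = Some True"
        using w func by (auto simp: fval_pairwise_sim_TS simeq_def pint_TS_sim o_def)
    qed
  next
    case (pred P xs ys)
    show ?thesis
    proof (rule that[OF pred(1)])
      fix w assume w: "evaluation TS w"
      have "fval (two L) TS w (Iff (Pred P (map Var xs)) (Pred P (map Var ys))) = Some True"
        if "map w xs = map w ys"
        using that by (intro fval_Iff_refl) (simp add: o_def)
      \<comment> \<open>Even with a false antecedent, an implication has a value only if its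
        consequent is defined.\<close>
      moreover have "fval (two L) TS w (Iff (Pred P (map Var xs)) (Pred P (map Var ys))) \<noteq> None"
        by (rule fval_two_defined)
      ultimately show "fval (two L) TS w (Imp (pairwise_sim \<Sigma> xs ys)
          (Iff (Pred P (map Var xs)) (Pred P (map Var ys)))) = Some True"
        using w pred by (auto simp: fval_pairwise_sim_TS)
    qed
  qed
  then show "fval (two L) TS w \<alpha> = Some (one (two L))"
    using assms by (simp add: fval_two_foldr_Forall)
qed

lemma is_structure_TS: "is_structure L \<Sigma> (two L) TS"
  using L_algebra_two A_structure_TS models_sim_TS fval_two_defined
  unfolding is_structure_def safe_def by blast

lemma reduced_TS: "reduced \<Sigma> (two L) TS"
  by (simp add: reduced_def pint_TS_sim)

lemma evaluation_canonical: "evaluation TS (canonical_evaluation L \<Sigma> \<Phi>)"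
  by (simp add: evaluation_def canonical_evaluation_def cls_in_univ)

end


section \<open>The homomorphism into a reduced model\<close>

locale free_extension = term_model L \<Sigma> \<Phi> + L_structure L \<Sigma> A M
  for L :: "'c logic" and \<Sigma> :: "('f, 'p) language" and \<Phi> :: "('f, 'p, 'c) fml set"
    and A :: "('a, 'c) algebra" and M :: "('m, 'f, 'p, 'a) struct" +
  fixes v :: "var \<Rightarrow> 'm"
  assumes reduced: "reduced \<Sigma> A M" and eval: "evaluation M v" and model: "models A M v \<Phi>"
begin

definition alg_map :: "bool \<Rightarrow> 'a" where
  "alg_map b = (if b then one A else zero A)"

text \<open>A representative is chosen arbitrarily; \<open>tval_eqI\<close> makes the choice
  harmless. The restriction makes the map extensional, as homomorphisms are required to be.\<close>

definition dom_map :: "'f trm set \<Rightarrow> 'm" where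
  "dom_map = restrict (\<lambda>c. tval M v (SOME t. twf \<Sigma> t \<and> cls t = c)) (univ TS)"

lemma pval_carrier: "pwf L \<phi> \<Longrightarrow> (\<And>p. e p \<in> carrier A) \<Longrightarrow> pval A e \<phi> \<in> carrier A"
proof (induction \<phi>)
  case (PConn c \<phi>s)
  then have "set (map (pval A e) \<phi>s) \<subseteq> carrier A" by auto
  then show ?case using PConn.prems(1) L_alg unfolding L_algebra_def by simp
qed simp_all

text \<open>A closed formula is either derivable, hence of value 1 in both algebras by soundness, or
  equivalent to 0, hence of value 0 in both.\<close>

lemma pval_closed:
  assumes "pwf L \<phi>" "pvars \<phi> = {}" and e: "\<And>p. e p \<in> carrier A"
  shows "pval A e \<phi> = alg_map (pval (two L) e' \<phi>)"
proof -
  have "pval (two L) e' \<phi> \<longleftrightarrow> pderiv L {} \<phi>"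
    using assms by (simp add: pval_two psubst_closed)
  moreover have "pval A e \<phi> = one A" if "pderiv L {} \<phi>"
    using that e by (rule pderiv_sound) auto
  moreover have "pval A e \<phi> = zero A" if "\<not> pderiv L {} \<phi>"
  proof -
    have "pderiv L {} (PIff \<phi> PBot)"
      using closed_iff_truth_const[OF assms(1,2)] that by (simp add: truth_const_def)
    then have "pval A e (PIff \<phi> PBot) = one A"
      using e by (rule pderiv_sound) auto
    then have "mult A (resid A (pval A e \<phi>) (zero A)) (resid A (zero A) (pval A e \<phi>)) = one A"
      by (simp add: PIff_def)
    moreover have a: "pval A e \<phi> \<in> carrier A"
      using assms(1) e by (rule pval_carrier)
    \<comment> \<open>An equivalence is a fusion of two implications, and a product equals 1 only if
      its factors do.\<close>
    ultimately have "resid A (pval A e \<phi>) (zero A) = one A"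
      using mult_eq_oneD resid_carrier zero_carrier by metis
    then have "ale A (pval A e \<phi>) (zero A)"
      using a by (simp add: resid_eq_one_iff)
    then show ?thesis
      using a le_antisym zero_le by simp
  qed
  ultimately show ?thesis by (simp add: alg_map_def)
qed

lemma pval_truth_const: "pval A e (truth_const b) = alg_map b"
  and pval_two_truth_const: "pval (two L) e' (truth_const b) = b"
  by (simp_all add: truth_const_def alg_map_def)

text \<open>Preservation of an operation at given truth values is \<open>pval_closed\<close> for
  that connective applied to the corresponding constants; this treats the extra connectives like the
  basic ones.\<close>

lemma algebra_hom_alg_map: "algebra_hom L (two L) A alg_map"
proof -
  have *: "pval A (\<lambda>_. one A) \<phi> = alg_map (pval (two L) (\<lambda>_. True) \<phi>)"
    if "pwf L \<phi>" "pvars \<phi> = {}" for \<phi>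
    using that by (intro pval_closed) auto
  have "alg_map (oper (two L) c bs) = oper A c (map alg_map bs)"
    if "c \<in> conns L" "length bs = carity L c" for c bs
    using *[of "PConn c (map truth_const bs)"] that
    by (simp add: o_def pval_truth_const pval_two_truth_const)
  moreover have "alg_map (x \<and> y) = meet A (alg_map x) (alg_map y)"
    "alg_map (x \<or> y) = join A (alg_map x) (alg_map y)"
    "alg_map (x \<and> y) = mult A (alg_map x) (alg_map y)"
    "alg_map (x \<longrightarrow> y) = resid A (alg_map x) (alg_map y)" for x y
    using *[of "PAnd (truth_const x) (truth_const y)"] *[of "POr (truth_const x) (truth_const y)"]
      *[of "PFus (truth_const x) (truth_const y)"] *[of "PImp (truth_const x) (truth_const y)"]
    by (simp_all add: pval_truth_const pval_two_truth_const)
  ultimately show ?thesis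
    by (auto simp: algebra_hom_def alg_map_def)
qed

section \<open>The map between the domains\<close>

lemma tval_eqI:
  assumes "twf \<Sigma> s" "twf \<Sigma> t" "cls s = cls t"
  shows "tval M v s = tval M v t"
proof -
  have "prv L \<Sigma> \<Phi> (simeq \<Sigma> s t)"
    using assms by (simp add: cls_eq_iff)
  then have "fval A M v (simeq \<Sigma> s t) = Some (one A)"
    using eval model by (rule prv_sound)
  then show ?thesis
    using reduced assms eval by (simp add: simeq_def reduced_def tval_univ)
qed

lemma dom_map_cls:
  assumes "twf \<Sigma> t"
  shows "dom_map (cls t) = tval M v t"
proof -
  let ?s = "SOME s. twf \<Sigma> s \<and> cls s = cls t"
  have "twf \<Sigma> ?s \<and> cls ?s = cls t"
    using assms by (metis (mono_tags, lifting) someI_ex)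
  then show ?thesis
    using assms tval_eqI[of ?s t] by (simp add: dom_map_def cls_in_univ)
qed

lemma map_dom_map_cls:
  "\<forall>t\<in>set ts. twf \<Sigma> t \<Longrightarrow> map dom_map (map cls ts) = map (tval M v) ts"
  by (simp add: dom_map_cls)

lemma homomorphism_maps: "homomorphism L \<Sigma> (two L) TS A M alg_map dom_map"
  unfolding homomorphism_def
proof (intro conjI ballI allI impI algebra_hom_alg_map)
  show "dom_map \<in> univ TS \<rightarrow>\<^sub>E univ M"
    using eval by (auto simp: univ_TS dom_map_cls tval_univ) (simp add: dom_map_def univ_TS)
next
  fix F cs assume *: "F \<in> funs \<Sigma>" "length cs = farity \<Sigma> F" "set cs \<subseteq> univ TS"
  obtain ts where ts: "\<forall>t\<in>set ts. twf \<Sigma> t" "cs = map cls ts"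
    using ex_representatives[OF *(3)] by blast
  then have "dom_map (fint TS F cs) = tval M v (Fn F ts)"
    using * by (simp add: fint_TS dom_map_cls)
  then show "dom_map (fint TS F cs) = fint M F (map dom_map cs)"
    using ts by (simp only: map_dom_map_cls tval.simps)
next
  fix P cs assume "pint TS P cs = one (two L)"
  then obtain ts where ts: "\<forall>t\<in>set ts. twf \<Sigma> t" "cs = map cls ts" "prv L \<Sigma> \<Phi> (Pred P ts)"
    unfolding pint_TS two_simps eq_True by (elim exE conjE) (rule that)
  then have "fval A M v (Pred P ts) = Some (one A)"
    using eval model by (intro prv_sound)
  then show "pint M P (map dom_map cs) = one A"
    using ts(1) unfolding ts(2) by (simp only: map_dom_map_cls fval.simps option.inject)
qed

text \<open>The algebra part is fixed because 0 and 1 are all of \<open>two L\<close>. The domain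
  part is fixed on variables and commutes with function symbols, so induction on terms determines it
  on the universe; extensionality settles it elsewhere.\<close>

lemma homomorphism_unique:
  assumes "homomorphism L \<Sigma> (two L) TS A M f g" and "\<And>x. g (cls (Var x)) = v x"
  shows "f = alg_map \<and> g = dom_map"
proof
  show "f = alg_map"
    using assms(1) by (auto simp: homomorphism_def algebra_hom_def alg_map_def)
  have g: "g \<in> univ TS \<rightarrow>\<^sub>E univ M"
    and gF: "F \<in> funs \<Sigma> \<Longrightarrow> length cs = farity \<Sigma> F \<Longrightarrow> set cs \<subseteq> univ TS \<Longrightarrow>
      g (fint TS F cs) = fint M F (map g cs)" for F cs
    using assms(1) unfolding homomorphism_def by blast+
  have "g (cls t) = tval M v t" if "twf \<Sigma> t" for t
    using that
  proof (induction t)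
    case (Fn F ts)
    then have "map g (map cls ts) = map (tval M v) ts" by simp
    moreover have "set (map cls ts) \<subseteq> univ TS"
      using Fn.prems by (auto intro: cls_in_univ)
    ultimately have "g (fint TS F (map cls ts)) = tval M v (Fn F ts)"
      using Fn.prems gF[of F "map cls ts"] by (simp del: map_map)
    then show ?case using Fn.prems by (simp add: fint_TS)
  qed (simp add: assms(2))
  then have "g c = dom_map c" if "c \<in> univ TS" for c
    using that by (auto simp: univ_TS dom_map_cls)
  moreover have "dom_map \<in> univ TS \<rightarrow>\<^sub>E univ M"
    using homomorphism_maps by (simp add: homomorphism_def)
  ultimately show "g = dom_map"
    using g by (blast intro: PiE_ext)
qed

end

theorem theorem1:
  fixes L :: "'c logic" and \<Sigma> :: "('f, 'p) language" and \<Phi> :: "('f, 'p, 'c) fml set"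
  assumes "core_fuzzy_logic L" and "only_constants_0_1 L"
    and "similarity_language \<Sigma>"
    and "\<forall>\<phi>\<in>\<Phi>. fwf L \<Sigma> \<phi>"
    and "consistent L \<Sigma> \<Phi>"
    and "models (two L) (term_structure L \<Sigma> \<Phi>) (canonical_evaluation L \<Sigma> \<Phi>) \<Phi>"
  shows "reduced_model L \<Sigma> \<Phi> (two L) (term_structure L \<Sigma> \<Phi>) (canonical_evaluation L \<Sigma> \<Phi>) \<and>
    (\<forall>(A :: ('a, 'c) algebra) (M :: ('m, 'f, 'p, 'a) struct) v.
       reduced_model L \<Sigma> \<Phi> A M v \<longrightarrow>
       (\<exists>!(f, g). homomorphism L \<Sigma> (two L) (term_structure L \<Sigma> \<Phi>) A M f g \<and>
          (\<forall>x. g (tclass L \<Sigma> \<Phi> (Var x)) = v x)))"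
proof -
  interpret term_model L \<Sigma> \<Phi>
    using assms(1-3,5) by unfold_locales
  show ?thesis
  proof (intro conjI allI impI)
    \<comment> \<open>The assumed value 1 of \<open>\<Phi>\<close> under the canonical evaluation
      places the term structure itself in the class.\<close>
    show "reduced_model L \<Sigma> \<Phi> (two L) TS (canonical_evaluation L \<Sigma> \<Phi>)"
      using assms(6) is_structure_TS reduced_TS evaluation_canonical
      unfolding reduced_model_def by blast
  next
    fix A :: "('a, 'c) algebra" and M :: "('m, 'f, 'p, 'a) struct" and v
    assume "reduced_model L \<Sigma> \<Phi> A M v"
    then interpret free_extension L \<Sigma> \<Phi> A M v
      using sim_lang by unfold_locales (simp_all add: reduced_model_def)
    show "\<exists>!(f, g). homomorphism L \<Sigma> (two L) TS A M f g \<and> (\<forall>x. g (cls (Var x)) = v x)"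
      by (rule ex1I[of _ "(alg_map, dom_map)"])
        (auto simp: homomorphism_maps dom_map_cls dest: homomorphism_unique)
  qed
qed


end
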